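(* Let $n\ge1$, $\ell\ge1$ and $0\le i\le n$ be integers and let $\mathfrak g$ be of type $A_n^{(1)}$. Then the number of dominant maximal weights of the irreducible highest weight module $V((\ell-1)\Lambda_0+\Lambda_i)$ is $$\bigl|\max{}^+((\ell-1)\Lambda_0+\Lambda_i)\bigr|=\sum_{d\mid (n+1,\ell,i)}\frac{d}{(n+1)+\ell}\ \sum_{d'\mid\left(\frac{n+1}{d},\frac{\ell}{d}\right)}\mu(d')\binom{((n+1)+\ell)/dd'}{\ell/dd'} ,$$ where $\mu$ is the classical Möbius function.
   Context: Here $(a,b)$ and $(a,b,c)$ denote greatest common divisors (with $\gcd(a,b,0)=\gcd(a,b)$), and sums over $d\mid N$ run over positive divisors. $\Lambda_0,\dots,\Lambda_n$ are the fundamental weights of $A_n^{(1)}$ and $\delta$ is the null root. For a dominant integral weight $\Lambda$, a weight $\mu$ of the irreducible highest weight module $V(\Lambda)$ is maximal if $\mu+\delta$ is not a weight of $V(\Lambda)$, and $\max^+(\Lambda)$ is the set of maximal weights of $V(\Lambda)$ that are dominant integral. *)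

theory Defs
  imports Complex_Main "HOL-Computational_Algebra.Computational_Algebra"
begin

section \<open>The affine Cartan datum of type \<open>A\<^sub>n\<^sup>(\<^sup>1\<^sup>)\<close>\<close>

text \<open>
  The nodes of the Dynkin diagram are \<open>0, \<dots>, n\<close>, arranged on a cycle of length \<open>n + 1\<close>.
  Neighbours are counted with multiplicity, so that the off-diagonal entries are \<open>-2\<close>
  for \<open>n = 1\<close>, where both neighbours of a node coincide.
\<close>

definition cartan_A :: "nat \<Rightarrow> nat \<Rightarrow> nat \<Rightarrow> int" where
  "cartan_A n i j =
     2 * of_bool (i = j)
     - of_bool (j = (i + 1) mod (n + 1))
     - of_bool (i = (j + 1) mod (n + 1))"

text \<open>
  The realization \<open>(\<hh>, \<Pi>, \<Pi>\<^sup>\<or>)\<close>: the complex vector space \<open>\<hh>\<close> is the whole type \<open>'h\<close>, with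
  basis the simple coroots \<open>hc 0, \<dots>, hc n\<close> and the scaling element \<open>d\<close>. Its dimension is
  \<open>n + 2 = 2 (n + 1) - rank A\<close>, and the conditions below force the simple roots \<open>\<alpha> j\<close> to be
  linearly independent. Elements of \<open>\<hh>\<^sup>*\<close> are the linear maps \<open>'h \<Rightarrow> complex\<close>.
\<close>

locale affine_A_datum = H: vector_space sh
  for sh :: "complex \<Rightarrow> 'h::ab_group_add \<Rightarrow> 'h" +
  fixes n :: nat
    and hc :: "nat \<Rightarrow> 'h"
    and d :: 'h
    and \<alpha> :: "nat \<Rightarrow> 'h \<Rightarrow> complex"
  assumes rank_pos: "1 \<le> n"
    and coroots_inj: "inj_on hc {..n}"
    and d_notin_coroots: "d \<notin> hc ` {..n}"
    and basis_independent: "H.independent (insert d (hc ` {..n}))"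
    and basis_span: "H.span (insert d (hc ` {..n})) = UNIV"
    and root_linear: "j \<le> n \<Longrightarrow> Vector_Spaces.linear sh (*) (\<alpha> j)"
    and root_coroot: "i \<le> n \<Longrightarrow> j \<le> n \<Longrightarrow> \<alpha> j (hc i) = of_int (cartan_A n i j)"
    and root_d: "j \<le> n \<Longrightarrow> \<alpha> j d = of_bool (j = 0)"

definition fundamental_weight ::
  "(complex \<Rightarrow> 'h::ab_group_add \<Rightarrow> 'h) \<Rightarrow> nat \<Rightarrow> (nat \<Rightarrow> 'h) \<Rightarrow> 'h \<Rightarrow> nat \<Rightarrow> 'h \<Rightarrow> complex" where
  "fundamental_weight sh n hc d i =
     (THE \<phi>. Vector_Spaces.linear sh (*) \<phi> \<and> (\<forall>j\<le>n. \<phi> (hc j) = of_bool (i = j)) \<and> \<phi> d = 0)"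

text \<open>In type \<open>A\<^sub>n\<^sup>(\<^sup>1\<^sup>)\<close> all marks are \<open>1\<close>, so the null root is the sum of the simple roots.\<close>

definition null_root :: "nat \<Rightarrow> (nat \<Rightarrow> 'h \<Rightarrow> complex) \<Rightarrow> 'h \<Rightarrow> complex" where
  "null_root n \<alpha> h = (\<Sum>j\<le>n. \<alpha> j h)"

definition dominant_integral :: "nat \<Rightarrow> (nat \<Rightarrow> 'h) \<Rightarrow> ('h \<Rightarrow> complex) \<Rightarrow> bool" where
  "dominant_integral n hc \<phi> \<longleftrightarrow> (\<forall>i\<le>n. \<phi> (hc i) \<in> \<nat>)"


section \<open>The affine Kac--Moody algebra\<close>

locale lie_algebra = L: vector_space sg
  for sg :: "complex \<Rightarrow> 'g::ab_group_add \<Rightarrow> 'g" +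
  fixes br :: "'g \<Rightarrow> 'g \<Rightarrow> 'g"
  assumes bracket_linear_right: "Vector_Spaces.linear sg sg (br x)"
    and bracket_linear_left: "Vector_Spaces.linear sg sg (\<lambda>x. br x y)"
    and bracket_self: "br x x = 0"
    and jacobi: "br x (br y z) + br y (br z x) + br z (br x y) = 0"
begin

definition subalgebra :: "'g set \<Rightarrow> bool" where
  "subalgebra S \<longleftrightarrow> L.subspace S \<and> (\<forall>x\<in>S. \<forall>y\<in>S. br x y \<in> S)"

definition lie_ideal :: "'g set \<Rightarrow> bool" where
  "lie_ideal J \<longleftrightarrow> L.subspace J \<and> (\<forall>x. \<forall>y\<in>J. br x y \<in> J)"

end

text \<open>
  The Kac--Moody algebra of the Cartan matrix \<open>A\<close>: the quotient of the Lie algebra presented by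
  \<open>\<hh>\<close>, \<open>e i\<close>, \<open>f i\<close> and the relations below by its largest ideal meeting \<open>\<hh>\<close> trivially. That is,
  it is generated by these elements subject to these relations, \<open>\<hh>\<close> embeds into it (via
  \<open>\<iota>\<close>), and no nonzero ideal meets \<open>\<hh>\<close> trivially; this determines it up to isomorphism.
\<close>

locale affine_A_algebra =
  affine_A_datum sh n hc d \<alpha> + lie_algebra sg br
  for sh :: "complex \<Rightarrow> 'h::ab_group_add \<Rightarrow> 'h"
    and n :: nat
    and hc :: "nat \<Rightarrow> 'h"
    and d :: 'h
    and \<alpha> :: "nat \<Rightarrow> 'h \<Rightarrow> complex"
    and sg :: "complex \<Rightarrow> 'g::ab_group_add \<Rightarrow> 'g"
    and br :: "'g \<Rightarrow> 'g \<Rightarrow> 'g" +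
  fixes \<iota> :: "'h \<Rightarrow> 'g"
    and e :: "nat \<Rightarrow> 'g"
    and f :: "nat \<Rightarrow> 'g"
  assumes cartan_linear: "Vector_Spaces.linear sh sg \<iota>"
    and cartan_inj: "inj \<iota>"
    and cartan_abelian: "br (\<iota> h) (\<iota> h') = 0"
    and bracket_e_f: "i \<le> n \<Longrightarrow> j \<le> n \<Longrightarrow> br (e i) (f j) = (if i = j then \<iota> (hc i) else 0)"
    and bracket_h_e: "i \<le> n \<Longrightarrow> br (\<iota> h) (e i) = sg (\<alpha> i h) (e i)"
    and bracket_h_f: "i \<le> n \<Longrightarrow> br (\<iota> h) (f i) = sg (- \<alpha> i h) (f i)"
    and generated: "subalgebra hull (range \<iota> \<union> e ` {..n} \<union> f ` {..n}) = UNIV"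
    and no_ideal: "lie_ideal J \<Longrightarrow> J \<inter> range \<iota> = {0} \<Longrightarrow> J = {0}"


section \<open>Modules and weights\<close>

locale lie_module =
  lie_algebra sg br + V: vector_space sv
  for sg :: "complex \<Rightarrow> 'g::ab_group_add \<Rightarrow> 'g"
    and br :: "'g \<Rightarrow> 'g \<Rightarrow> 'g"
    and sv :: "complex \<Rightarrow> 'v::ab_group_add \<Rightarrow> 'v" +
  fixes \<rho> :: "'g \<Rightarrow> 'v \<Rightarrow> 'v"
  assumes action_linear: "Vector_Spaces.linear sv sv (\<rho> x)"
    and action_linear_left: "Vector_Spaces.linear sg sv (\<lambda>x. \<rho> x v)"
    and action_bracket: "\<rho> (br x y) v = \<rho> x (\<rho> y v) - \<rho> y (\<rho> x v)"
begin

definition submodule :: "'v set \<Rightarrow> bool" where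
  "submodule W \<longleftrightarrow> V.subspace W \<and> (\<forall>x. \<forall>w\<in>W. \<rho> x w \<in> W)"

definition irreducible_module :: bool where
  "irreducible_module \<longleftrightarrow>
     (\<exists>v::'v. v \<noteq> 0) \<and> (\<forall>W. submodule W \<longrightarrow> W = {0} \<or> W = UNIV)"

end

definition weight_space ::
  "(complex \<Rightarrow> 'v::ab_group_add \<Rightarrow> 'v) \<Rightarrow> ('h \<Rightarrow> 'g) \<Rightarrow> ('g \<Rightarrow> 'v \<Rightarrow> 'v) \<Rightarrow> ('h \<Rightarrow> complex) \<Rightarrow> 'v set"
  where "weight_space sv \<iota> \<rho> \<mu> = {v. \<forall>h. \<rho> (\<iota> h) v = sv (\<mu> h) v}"

text \<open>
  \<open>V(\<Lambda>)\<close> is the irreducible module, unique up to isomorphism, that is generated by a vector of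
  weight \<open>\<Lambda>\<close> annihilated by the subalgebra \<open>\<nn>\<^sub>+\<close> generated by the \<open>e i\<close>.
\<close>

locale irreducible_hw_module =
  affine_A_algebra sh n hc d \<alpha> sg br \<iota> e f + lie_module sg br sv \<rho>
  for sh :: "complex \<Rightarrow> 'h::ab_group_add \<Rightarrow> 'h"
    and n :: nat
    and hc :: "nat \<Rightarrow> 'h"
    and d :: 'h
    and \<alpha> :: "nat \<Rightarrow> 'h \<Rightarrow> complex"
    and sg :: "complex \<Rightarrow> 'g::ab_group_add \<Rightarrow> 'g"
    and br :: "'g \<Rightarrow> 'g \<Rightarrow> 'g"
    and \<iota> :: "'h \<Rightarrow> 'g"
    and e :: "nat \<Rightarrow> 'g"
    and f :: "nat \<Rightarrow> 'g"
    and sv :: "complex \<Rightarrow> 'v::ab_group_add \<Rightarrow> 'v"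
    and \<rho> :: "'g \<Rightarrow> 'v \<Rightarrow> 'v" +
  fixes \<Lambda> :: "'h \<Rightarrow> complex"
  assumes irreducible: "irreducible_module"
    and highest_weight: "Vector_Spaces.linear sh (*) \<Lambda>"
    and highest_weight_vector:
      "\<exists>v. v \<noteq> 0 \<and> v \<in> weight_space sv \<iota> \<rho> \<Lambda>
         \<and> (\<forall>x \<in> subalgebra hull (e ` {..n}). \<rho> x v = 0)
         \<and> submodule hull {v} = UNIV"

definition weights ::
  "(complex \<Rightarrow> 'h::ab_group_add \<Rightarrow> 'h) \<Rightarrow> (complex \<Rightarrow> 'v::ab_group_add \<Rightarrow> 'v)
    \<Rightarrow> ('h \<Rightarrow> 'g) \<Rightarrow> ('g \<Rightarrow> 'v \<Rightarrow> 'v) \<Rightarrow> ('h \<Rightarrow> complex) set" where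
  "weights sh sv \<iota> \<rho> = {\<mu>. Vector_Spaces.linear sh (*) \<mu> \<and> weight_space sv \<iota> \<rho> \<mu> \<noteq> {0}}"

definition maximal_weights ::
  "(complex \<Rightarrow> 'h::ab_group_add \<Rightarrow> 'h) \<Rightarrow> nat \<Rightarrow> (nat \<Rightarrow> 'h \<Rightarrow> complex)
    \<Rightarrow> (complex \<Rightarrow> 'v::ab_group_add \<Rightarrow> 'v) \<Rightarrow> ('h \<Rightarrow> 'g) \<Rightarrow> ('g \<Rightarrow> 'v \<Rightarrow> 'v) \<Rightarrow> ('h \<Rightarrow> complex) set"
  where
  "maximal_weights sh n \<alpha> sv \<iota> \<rho> =
     {\<mu> \<in> weights sh sv \<iota> \<rho>. (\<lambda>h. \<mu> h + null_root n \<alpha> h) \<notin> weights sh sv \<iota> \<rho>}"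

definition dominant_maximal_weights ::
  "(complex \<Rightarrow> 'h::ab_group_add \<Rightarrow> 'h) \<Rightarrow> nat \<Rightarrow> (nat \<Rightarrow> 'h) \<Rightarrow> (nat \<Rightarrow> 'h \<Rightarrow> complex)
    \<Rightarrow> (complex \<Rightarrow> 'v::ab_group_add \<Rightarrow> 'v) \<Rightarrow> ('h \<Rightarrow> 'g) \<Rightarrow> ('g \<Rightarrow> 'v \<Rightarrow> 'v) \<Rightarrow> ('h \<Rightarrow> complex) set"
  where
  "dominant_maximal_weights sh n hc \<alpha> sv \<iota> \<rho> =
     {\<mu> \<in> maximal_weights sh n \<alpha> sv \<iota> \<rho>. dominant_integral n hc \<mu>}"


section \<open>The Moebius function\<close>

definition moebius :: "nat \<Rightarrow> int" where
  "moebius m = (if squarefree m then (- 1) ^ card (prime_factors m) else 0)"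

end

theory Submission
  imports Defs
begin

text \<open>
  All weights of \<open>V(\<Lambda>)\<close> have the form \<open>\<Lambda> - \<Sum>k\<^sub>j\<alpha>\<^sub>j\<close> with \<open>k\<^sub>j \<ge> 0\<close>, and conversely every dominant
  integral functional of this form is a weight because the level of \<open>\<Lambda>\<close> is positive. The labels
  \<open>m\<^sub>j = \<mu>(hc j)\<close> determine \<open>\<mu>\<close> up to multiples of the null root, so each admissible label vector
  belongs to exactly one dominant maximal weight. A vector \<open>m \<in> \<nat>\<^sup>n\<^sup>+\<^sup>1\<close> is admissible
  iff \<open>\<Sum>m\<^sub>j\<close> is the level and \<open>\<Sum>j m\<^sub>j \<equiv> i\<close> modulo \<open>n + 1\<close>; this is the solvability criterion
  for the Laplacian of the cycle.

  A roots-of-unity filter counts these vectors: for \<open>z\<close> of order \<open>D\<close>, the coefficient of \<open>X\<^sup>l\<close> in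
  \<open>\<Prod>\<^sub>j (1 - z\<^sup>j X)\<^sup>-\<^sup>1 = (1 - X\<^sup>D)\<^sup>-\<^sup>(\<^sup>n\<^sup>+\<^sup>1\<^sup>)\<^sup>/\<^sup>D\<close> is a binomial coefficient, and summing over
  all \<open>z\<close> of order \<open>D\<close> gives Ramanujan sums, which Moebius inversion evaluates.
\<close>

section \<open>Counting compositions with a weight condition\<close>

lemma of_real_of_bool: "of_real (of_bool P) = of_bool P"
  by simp

section \<open>Divisor sums of the Moebius function\<close>

lemma sum_involution_sign_eq_0:
  fixes f :: "'a \<Rightarrow> 'b::{idom,ring_char_0}"
  assumes "\<And>x. x \<in> A \<Longrightarrow> g x \<in> A" "\<And>x. x \<in> A \<Longrightarrow> g (g x) = x"
    and "\<And>x. x \<in> A \<Longrightarrow> f (g x) = - f x"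
  shows "sum f A = 0"
proof -
  have "bij_betw g A A"
    by (rule bij_betw_byWitness[where f' = g]) (use assms in auto)
  then have "sum f A = (\<Sum>x\<in>A. f (g x))"
    by (rule sum.reindex_bij_betw[symmetric])
  also have "\<dots> = - sum f A"
    using assms(3) by (simp add: sum_negf)
  finally have "2 * sum f A = 0" by simp
  then show ?thesis by simp
qed

lemma moebius_mult_prime:
  assumes "prime p" "\<not> p dvd m" "squarefree m"
  shows "moebius (p * m) = - moebius m"
proof -
  have m0: "m \<noteq> 0" using assms(2) by (metis dvd_0_right)
  have "coprime p m" using assms by (simp add: prime_imp_coprime)
  then have sf: "squarefree (p * m)"
    using assms by (simp add: squarefree_mult_coprime squarefree_prime)
  have "prime_factors (p * m) = insert p (prime_factors m)"
    using assms m0 by (simp add: prime_factors_product prime_factorization_prime)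
  moreover have "p \<notin> prime_factors m" using assms(2) by auto
  ultimately show ?thesis using sf assms(3) by (simp add: moebius_def)
qed

text \<open>Toggling a fixed prime factor \<open>p\<close> of \<open>m\<close> pairs off the
  squarefree divisors with opposite signs; the other divisors contribute 0.\<close>

lemma sum_moebius_divisors:
  assumes "0 < m"
  shows "(\<Sum>d | d dvd m. moebius d) = of_bool (m = 1)"
proof (cases "m = 1")
  case True
  then show ?thesis by (simp add: moebius_def)
next
  case False
  then obtain p where p: "prime p" "p dvd m"
    using prime_factor_nat by blast
  define A where "A = {d. d dvd m \<and> squarefree d}"
  define g where "g d = (if p dvd d then d div p else p * d)" for d
  have p0: "p > 0" using p prime_gt_0_nat by blast
  have ndvd: "\<not> p dvd d div p" if "squarefree d" "p dvd d" for d
  proof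
    assume "p dvd d div p"
    then have "p * p dvd p * (d div p)" by simp
    then have "p^2 dvd d" using that by (simp add: power2_eq_square)
    then have "is_unit p" using that(1) by (auto simp: squarefree_def)
    then show False using p by auto
  qed
  have gsf: "g d \<in> A \<and> g (g d) = d \<and> moebius (g d) = - moebius d" if "d \<in> A" for d
  proof (cases "p dvd d")
    case True
    then obtain c where c: "d = p * c" by blast
    have gd: "g d = c" using c True p0 by (simp add: g_def)
    have nc: "\<not> p dvd c" using ndvd[of d] that True c p0 by (simp add: A_def)
    have sfc: "squarefree c" using that c squarefree_mono[of c d] by (auto simp: A_def)
    show ?thesis using gd nc sfc c that moebius_mult_prime[OF p(1) nc sfc]
      by (auto simp: A_def g_def intro: dvd_mult_right)
  next
    case False
    have sfd: "squarefree d" using that by (simp add: A_def)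
    have cop: "coprime p d" using p False by (simp add: prime_imp_coprime)
    have "p * d dvd m" using cop p that by (simp add: A_def divides_mult)
    moreover have "squarefree (p * d)"
      using cop p sfd by (simp add: squarefree_mult_coprime squarefree_prime)
    ultimately show ?thesis using False p0 moebius_mult_prime[OF p(1) False sfd]
      by (simp add: A_def g_def)
  qed
  have "(\<Sum>d | d dvd m. moebius d) = sum moebius A"
    by (rule sum.mono_neutral_right) (use assms in \<open>auto simp: A_def moebius_def\<close>)
  also have "\<dots> = 0"
    by (rule sum_involution_sign_eq_0[where g = g]) (use gsf in auto)
  finally show ?thesis using False by simp
qed

section \<open>Generating functions at roots of unity\<close>

lemma prod_periodic:
  fixes g :: "nat \<Rightarrow> 'a::comm_monoid_mult"
  assumes "\<And>j. g (j + D) = g j"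
  shows "(\<Prod>j<D * r. g j) = (\<Prod>j<D. g j) ^ r"
proof (induction r)
  case (Suc r)
  have per: "g (j + D * r) = g j" for j
  proof (induction r)
    case (Suc r)
    then show ?case using assms[of "j + D * r"] by (simp add: algebra_simps)
  qed simp
  have "(\<Prod>j<D * Suc r. g j) = (\<Prod>j<D * r. g j) * (\<Prod>j\<in>{D * r..<D * r + D}. g j)"
    by (subst prod.union_disjoint[symmetric]) (auto intro!: prod.cong)
  also have "(\<Prod>j\<in>{D * r..<D * r + D}. g j) = (\<Prod>j<D. g (j + D * r))"
    by (rule prod.reindex_bij_witness[of _ "\<lambda>j. j + D * r" "\<lambda>j. j - D * r"]) auto
  finally show ?case using Suc by (simp add: per mult.commute)
qed simp

text \<open>Both sides are polynomials of degree at most \<open>D\<close>. They vanish at the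
  inverses of \<open>z ^ j\<close>, which are \<open>D\<close> distinct points because
  \<open>z\<close> has exact order \<open>D\<close>, and they agree at 0 as well, which fixes the
  scalar factor.\<close>

lemma prod_one_minus_root_powers:
  fixes z :: complex
  assumes "0 < D" and order: "\<And>k. z ^ k = 1 \<longleftrightarrow> D dvd k"
  shows "(\<Prod>j<D. 1 - fps_const (z ^ j) * fps_X) = 1 - fps_X ^ D"
proof -
  define P where "P = 1 - monom (1::complex) D"
  define Q where "Q = (\<Prod>j<D. [:1, - (z ^ j):])"
  define A where "A = insert 0 ((\<lambda>j. inverse (z ^ j)) ` {..<D})"
  have zD: "z ^ D = 1" using order by simp
  have z0: "z \<noteq> 0" using zD assms(1) by (auto simp: power_0_left)
  have inj: "inj_on (\<lambda>j. inverse (z ^ j)) {..<D}"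
  proof -
    have *: "j = k" if "z ^ j = z ^ k" "j \<le> k" "k < D" for j k
    proof -
      have "z ^ k = z ^ j * z ^ (k - j)" using that by (subst power_add[symmetric]) simp
      then have "z ^ (k - j) = 1" using that z0 by simp
      then have "D dvd k - j" using order by simp
      then show ?thesis using that by (auto dest: dvd_imp_le)
    qed
    show ?thesis by (rule linorder_inj_onI) (use * in force)+
  qed
  have cardA: "card A = Suc D"
    using z0 unfolding A_def by (subst card_insert_disjoint) (auto simp: card_image[OF inj])
  have "P = Q"
  proof (rule poly_eqI_degree[of A])
    fix x assume "x \<in> A"
    then consider "x = 0" | j where "j < D" "x = inverse (z ^ j)" by (auto simp: A_def)
    then show "poly P x = poly Q x"
    proof cases
      case 1 then show ?thesis using assms(1) by (simp add: P_def Q_def poly_monom poly_prod)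
    next
      case 2
      have "poly P x = 0" using 2 zD by (simp add: P_def poly_monom power_inverse flip: power_mult)
        (simp add: mult.commute power_mult)
      moreover have "poly Q x = 0" using 2 z0 by (auto simp: Q_def poly_prod prod_zero_iff intro!: bexI[of _ j])
      ultimately show ?thesis by simp
    qed
  next
    have "degree P \<le> D" unfolding P_def
      by (rule order.trans[OF degree_diff_le_max]) (simp add: degree_monom_eq)
    then show "degree P < card A" using cardA by simp
  next
    have "degree Q \<le> sum (degree \<circ> (\<lambda>j. [:1, - (z ^ j):])) {..<D}" 
      unfolding Q_def by (rule degree_prod_sum_le) simp
    also have "\<dots> \<le> (\<Sum>j<D. 1)" by (rule sum_mono) simp
    finally show "degree Q < card A" using cardA by simp
  qed
  then have "fps_of_poly P = fps_of_poly Q" by simp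
  moreover have "fps_of_poly P = 1 - fps_X ^ D"
    by (simp add: P_def fps_of_poly_diff fps_of_poly_monom)
  moreover have "fps_of_poly Q = (\<Prod>j<D. 1 - fps_const (z ^ j) * fps_X)"
    by (simp add: Q_def fps_of_poly_prod fps_of_poly_pCons flip: fps_const_neg)
  ultimately show ?thesis by simp
qed

text \<open>Multiplying by \<open>1 - fps_X ^ D\<close> lowers \<open>r\<close> by one, by Pascal's
  rule. Truncated subtraction gives the right values for \<open>r = 0\<close>: the coefficient is
  \<open>0 choose 0 = 1\<close> at \<open>k = 0\<close> and 0 elsewhere.\<close>

lemma nth_inverse_one_minus_X_power:
  fixes D r :: nat
  assumes "0 < D"
  shows "Abs_fps (\<lambda>k. if D dvd k then of_nat ((r + k div D - 1) choose (k div D)) else 0)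
    * (1 - fps_X ^ D) ^ r = (1 :: complex fps)"
proof (induction r)
  case 0
  have "(if D dvd k then of_nat ((k div D - 1) choose (k div D)) else 0) = (if k = 0 then 1 else 0 :: complex)" for k
    using assms by (auto elim!: dvdE)
  then show ?case by (simp only: fps_eq_iff power_0 mult_1_right fps_nth_Abs_fps fps_one_nth add_0 simp_thms)
next
  case (Suc r)
  let ?G = "\<lambda>r. Abs_fps (\<lambda>k. if D dvd k then of_nat ((r + k div D - 1) choose (k div D)) else 0) :: complex fps"
  have "?G (Suc r) * (1 - fps_X ^ D) = ?G r"
  proof (rule fps_ext)
    fix k
    show "fps_nth (?G (Suc r) * (1 - fps_X ^ D)) k = fps_nth (?G r) k"
    proof (cases "D dvd k")
      case False
      then have "\<not> D dvd k - D" if "D \<le> k" using that by (simp add: dvd_minus_self)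
      then show ?thesis using False by (auto simp: right_diff_distrib fps_X_power_mult_right_nth)
    next
      case True
      then obtain q where q: "k = D * q" by blast
      show ?thesis
      proof (cases q)
        case 0 then show ?thesis using q assms by (simp add: right_diff_distrib fps_X_power_mult_right_nth)
      next
        case (Suc q')
        have 1: "k - D = D * q'" "\<not> k < D" using q Suc by auto
        show ?thesis using q Suc assms 1
          by (simp add: right_diff_distrib fps_X_power_mult_right_nth)
      qed
    qed
  qed
  moreover have "?G (Suc r) * (1 - fps_X ^ D) ^ Suc r = (?G (Suc r) * (1 - fps_X ^ D)) * (1 - fps_X ^ D) ^ r"
    by (simp only: power_Suc mult.assoc)
  ultimately show ?case using Suc by (simp only:)
qed

lemma fps_inverse_unique_right:
  fixes a b c :: "'a::comm_ring_1 fps"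
  assumes "a * c = 1" "b * c = 1"
  shows "a = b"
proof -
  have "a = a * (b * c)" using assms by simp
  also have "\<dots> = b * (a * c)" by (simp only: ac_simps)
  finally show ?thesis using assms by simp
qed

text \<open>Both sides are the coefficient of X^l in the product of the geometric series 1/(1 - z^j
  X). Expanding the product gives the left side; for the right side, the factors run
  \<open>r\<close> times through all powers of \<open>z\<close>, so the product is (1 -
  X^D)^(-r).\<close>

lemma sum_root_powers_natpermute:
  fixes z :: complex
  assumes "0 < D" and order: "\<And>k. z ^ k = 1 \<longleftrightarrow> D dvd k" and N: "n + 1 = D * r"
  shows "(\<Sum>xs\<in>natpermute l (n + 1). z ^ (\<Sum>j\<le>n. j * xs ! j)) =
    (if D dvd l then of_nat ((r + l div D - 1) choose (l div D)) else 0)"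
proof -
  define G where "G j = Abs_fps (\<lambda>m. (z ^ j) ^ m)" for j :: nat
  have zD: "z ^ D = 1" using order by simp
  have G: "G j * (1 - fps_const (z ^ j) * fps_X) = 1" for j
  proof (rule fps_ext)
    fix k show "fps_nth (G j * (1 - fps_const (z ^ j) * fps_X)) k = fps_nth 1 k"
      by (cases k) (simp_all add: G_def right_diff_distrib mult.assoc[symmetric])
  qed
  have "(\<Prod>j\<le>n. G j) * (1 - fps_X ^ D) ^ r = 1"
  proof -
    have "(1 - fps_X ^ D) ^ r = (\<Prod>j<D * r. 1 - fps_const (z ^ j) * fps_X)"
      using prod_one_minus_root_powers[OF assms(1) order] zD
      by (subst prod_periodic) (simp_all add: power_add)
    also have "{..<D * r} = {..n}" using N by auto
    finally show ?thesis by (simp add: G flip: prod.distrib)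
  qed
  moreover note nth_inverse_one_minus_X_power[OF assms(1), of r]
  ultimately have "(\<Prod>j\<le>n. G j) =
     Abs_fps (\<lambda>k. if D dvd k then of_nat ((r + k div D - 1) choose (k div D)) else 0)"
    by (rule fps_inverse_unique_right)
  then have "fps_nth (\<Prod>j\<le>n. G j) l =
     (if D dvd l then of_nat ((r + l div D - 1) choose (l div D)) else 0)" by simp
  moreover have "fps_nth (\<Prod>j\<le>n. G j) l = (\<Sum>xs\<in>natpermute l (n + 1). z ^ (\<Sum>j\<le>n. j * xs ! j))"
    using fps_prod_nth[of G n l] by (simp add: atMost_atLeast0 G_def power_sum power_mult)
  ultimately show ?thesis by simp
qed


text \<open>After the sums are interchanged, \<open>g j\<close> is weighted by the sum of
  \<open>moebius (m div k)\<close> over all \<open>k\<close> between \<open>j\<close> and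
  \<open>m\<close> in the divisor order. This is the full divisor sum for \<open>m div j\<close>,
  which vanishes unless \<open>j = m\<close>.\<close>

lemma moebius_inversion:
  fixes g h :: "nat \<Rightarrow> 'a::comm_ring_1"
  assumes "0 < m" and gh: "\<And>k. k dvd m \<Longrightarrow> (\<Sum>j | j dvd k. g j) = h k"
  shows "g m = (\<Sum>k | k dvd m. of_int (moebius (m div k)) * h k)"
proof -
  have inner: "(\<Sum>k | j dvd k \<and> k dvd m. moebius (m div k)) = of_bool (j = m)" if j: "j dvd m" for j
  proof -
    obtain q where q: "m = j * q" using j by blast
    have pos: "j > 0" "q > 0" using q assms(1) by auto
    have "(\<Sum>k | j dvd k \<and> k dvd m. moebius (m div k)) = (\<Sum>d | d dvd q. moebius d)"
      by (rule sum.reindex_bij_witness[of _ "\<lambda>d. m div d" "\<lambda>k. m div k"])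
        (use q pos in \<open>auto elim!: dvdE\<close>)
    also have "\<dots> = of_bool (q = 1)" using pos(2) by (rule sum_moebius_divisors)
    also have "(q = 1) = (j = m)" using q pos by auto
    finally show ?thesis .
  qed
  have "(\<Sum>k | k dvd m. of_int (moebius (m div k)) * h k)
      = (\<Sum>k | k dvd m. \<Sum>j | j dvd m \<and> j dvd k. of_int (moebius (m div k)) * g j)"
  proof (rule sum.cong[OF refl])
    fix k assume k: "k \<in> {k. k dvd m}"
    then have "{j. j dvd m \<and> j dvd k} = {j. j dvd k}" by (auto intro: dvd_trans)
    then show "of_int (moebius (m div k)) * h k =
        (\<Sum>j | j dvd m \<and> j dvd k. of_int (moebius (m div k)) * g j)"
      using gh k by (simp flip: sum_distrib_left)
  qed
  also have "\<dots> = (\<Sum>j | j dvd m. \<Sum>k | k dvd m \<and> j dvd k. of_int (moebius (m div k)) * g j)"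
    using sum.swap_restrict[of "{k. k dvd m}" "{j. j dvd m}"
        "\<lambda>k j. of_int (moebius (m div k)) * g j" "\<lambda>k j. j dvd k"] assms(1) by simp
  also have "\<dots> = (\<Sum>j | j dvd m. of_bool (j = m) * g j)"
  proof (rule sum.cong[OF refl])
    fix j assume j: "j \<in> {j. j dvd m}"
    have "(\<Sum>k | k dvd m \<and> j dvd k. of_int (moebius (m div k)) * g j) =
        of_int (\<Sum>k | j dvd k \<and> k dvd m. moebius (m div k)) * g j"
      by (simp add: sum_distrib_right conj_commute)
    also have "\<dots> = of_bool (j = m) * g j"
      using inner[of j] j by (simp only: mem_Collect_eq of_int_of_bool)
    finally show "(\<Sum>k | k dvd m \<and> j dvd k. of_int (moebius (m div k)) * g j) = of_bool (j = m) * g j" .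
  qed
  also have "\<dots> = g m" using assms(1) by (subst sum.remove[of _ m]) (auto intro!: sum.neutral)
  finally show ?thesis by simp
qed

section \<open>Roots-of-unity filter and Ramanujan sums\<close>

lemma cis_power_eq_1_iff:
  assumes "0 < N"
  shows "cis (2 * pi / real N) ^ k = 1 \<longleftrightarrow> N dvd k"
proof -
  let ?w = "cis (2 * pi / real N)"
  have pw: "?w ^ m = cis (2 * pi * real m / real N)" for m
    by (simp add: DeMoivre mult.commute)
  have w1: "?w ^ N = 1" using assms by (simp add: pw)
  have "?w ^ k = ?w ^ (k mod N)"
    by (metis mod_mult_div_eq power_add power_mult w1 power_one mult.right_neutral)
  also have "\<dots> = 1 \<longleftrightarrow> k mod N = 0"
  proof
    assume "?w ^ (k mod N) = 1"
    then have "cis (2 * pi * real (k mod N) / real N) = cis (2 * pi * real 0 / real N)"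
      by (simp add: pw)
    then show "k mod N = 0"
      using inj_onD[OF bij_betw_imp_inj_on[OF bij_betw_roots_unity[OF assms]], of "k mod N" 0] assms
      by simp
  qed simp
  finally show ?thesis by (simp add: mod_eq_0_iff_dvd)
qed

lemma sum_root_powers:
  fixes z :: complex
  assumes "0 < N" and "z ^ N = 1"
  shows "(\<Sum>t<N. z ^ t) = of_nat N * of_bool (z = 1)"
  using assms by (auto simp: geometric_sum)

text \<open>\<open>natpermute l (n + 1)\<close> consists of the lists of \<open>n + 1\<close>
  naturals with sum \<open>l\<close>. These lists will be the label vectors of the dominant maximal
  weights.\<close>

definition weighted_compositions :: "nat \<Rightarrow> nat \<Rightarrow> nat \<Rightarrow> nat list set" where
  "weighted_compositions n l i =
     {xs \<in> natpermute l (n + 1). (\<Sum>j\<le>n. j * xs ! j) mod (n + 1) = i mod (n + 1)}"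

lemma finite_weighted_compositions: "finite (weighted_compositions n l i)"
  unfolding weighted_compositions_def by (rule finite_subset[OF _ natpermute_finite]) auto

text \<open>The order of \<open>w ^ t\<close> is \<open>N div gcd t N\<close>, so the left side runs
  over the roots of unity of exact order \<open>D\<close>; the exponent \<open>N - i\<close> stands
  for \<open>- i\<close>. Collecting all orders dividing \<open>E\<close> gives a geometric sum over
  all \<open>E\<close>-th roots of unity, equal to \<open>E\<close> or 0 according to whether
  \<open>E\<close> divides \<open>i\<close>. Moebius inversion then isolates the order
  \<open>D\<close>.\<close>

lemma ramanujan_sum:
  fixes n i D :: nat
  defines "N \<equiv> n + 1"
  defines "w \<equiv> cis (2 * pi / real N)"
  assumes "i \<le> n" "D dvd N"
  shows "(\<Sum>t | t < N \<and> N div gcd t N = D. w ^ (t * (N - i))) =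
    (\<Sum>k | k dvd D. of_int (moebius (D div k)) * (of_nat k * of_bool (k dvd i)))"
proof (rule moebius_inversion)
  show "0 < D" using assms by (auto intro: dvd_pos_nat)
next
  fix E assume "E dvd D"
  then have EN: "E dvd N" using assms by (auto intro: dvd_trans)
  then obtain r where r: "N = E * r" by blast
  have N0: "N > 0" and E0: "E > 0" and r0: "r > 0" using r by (auto simp: N_def intro: Nat.gr0I)
  have w: "w ^ k = 1 \<longleftrightarrow> N dvd k" for k
    unfolding w_def by (rule cis_power_eq_1_iff[OF N0])
  have ord: "N div gcd t N dvd E \<longleftrightarrow> r dvd t" for t
  proof -
    have "N div gcd t N dvd E \<longleftrightarrow> N dvd E * gcd t N"
      using N0 by (subst div_dvd_iff_mult) auto
    also have "\<dots> \<longleftrightarrow> r dvd gcd t N" using r E0 by simp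
    also have "\<dots> \<longleftrightarrow> r dvd t" using r by auto
    finally show ?thesis .
  qed
  have "(\<Sum>D' | D' dvd E. \<Sum>t | t < N \<and> N div gcd t N = D'. w ^ (t * (N - i))) =
      (\<Sum>t | t < N \<and> N div gcd t N dvd E. w ^ (t * (N - i)))"
    by (subst sum.group[of "{t. t < N \<and> N div gcd t N dvd E}" "{D'. D' dvd E}" "\<lambda>t. N div gcd t N", symmetric])
      (use E0 in \<open>auto intro!: sum.cong\<close>)
  \<comment> \<open>The order of \<open>w ^ t\<close> divides \<open>E\<close> exactly when
    \<open>t\<close> is a multiple \<open>r * s\<close>.\<close>
  also have "\<dots> = (\<Sum>s<E. (w ^ (r * (N - i))) ^ s)"
    by (rule sum.reindex_bij_witness[of _ "\<lambda>s. r * s" "\<lambda>t. t div r"])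
      (use r r0 ord in \<open>auto simp: mult_ac div_less_iff_less_mult simp flip: power_mult\<close>)
  also have "\<dots> = of_nat E * of_bool (w ^ (r * (N - i)) = 1)"
    by (rule sum_root_powers[OF E0]) (use w r in \<open>simp flip: power_mult\<close>)
  also have "w ^ (r * (N - i)) = 1 \<longleftrightarrow> E dvd N - i"
    using w r r0 by (simp add: mult.commute[of E])
  also have "\<dots> \<longleftrightarrow> E dvd i"
    using EN assms by (metis N_def dvd_diffD1 dvd_diff_nat le_add1 le_trans)
  finally show "(\<Sum>D' | D' dvd E. \<Sum>t | t < N \<and> N div gcd t N = D'. w ^ (t * (N - i))) =
     of_nat E * of_bool (E dvd i)" .
qed

text \<open>The congruence on \<open>xs\<close> is detected by summing the powers of
  \<open>w ^ (s xs + (N - i))\<close>, which gives \<open>N\<close> or 0. For fixed \<open>t\<close>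
  the sum over \<open>xs\<close> depends only on the order of \<open>w ^ t\<close>, so grouping the
  \<open>t\<close> by order leaves the Ramanujan sum \<open>c D\<close> times the coefficient
  \<open>H D\<close>.\<close>

lemma card_weighted_compositions_ramanujan:
  fixes n l i :: nat
  defines "N \<equiv> n + 1"
  assumes "i \<le> n"
  shows "real N * real (card (weighted_compositions n l i)) =
    (\<Sum>D | D dvd gcd N l. (\<Sum>k | k dvd D. of_int (moebius (D div k)) * (real k * of_bool (k dvd i)))
        * real ((N div D + l div D - 1) choose (l div D)))"
proof -
  define w where "w = cis (2 * pi / real N)"
  define H where "H D = (if D dvd l then of_nat ((N div D + l div D - 1) choose (l div D)) else 0 :: complex)" for D
  define c where "c D = (\<Sum>k | k dvd D. of_int (moebius (D div k)) * (of_nat k * of_bool (k dvd i)) :: complex)" for D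
  define s where "s xs = (\<Sum>j\<le>n. j * xs ! j)" for xs :: "nat list"
  have N0: "N > 0" by (simp add: N_def)
  have w: "w ^ k = 1 \<longleftrightarrow> N dvd k" for k
    unfolding w_def by (rule cis_power_eq_1_iff[OF N0])
  have F: "(\<Sum>xs\<in>natpermute l N. (w ^ t) ^ s xs) = H (N div gcd t N)" for t
  proof -
    let ?D = "N div gcd t N"
    have D: "N = ?D * gcd t N" by simp
    have D0: "0 < ?D" using N0 D by (metis mult_0 not_gr_zero)
    have cop: "coprime ?D (t div gcd t N)"
      using N0 by (metis coprime_commute div_gcd_coprime not_gr_zero)
    have "(w ^ t) ^ k = 1 \<longleftrightarrow> ?D dvd k" for k
    proof -
      have "(w ^ t) ^ k = 1 \<longleftrightarrow> N dvd t * k" using w by (simp flip: power_mult)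
      also have "\<dots> \<longleftrightarrow> gcd t N * ?D dvd gcd t N * (t div gcd t N * k)"
        by (simp only: mult.assoc[symmetric] dvd_mult_div_cancel gcd_dvd1 gcd_dvd2)
      also have "\<dots> \<longleftrightarrow> ?D dvd t div gcd t N * k"
        using N0 by (subst dvd_times_left_cancel_iff) auto
      also have "\<dots> \<longleftrightarrow> ?D dvd k"
        using cop by (rule coprime_dvd_mult_right_iff)
      finally show ?thesis .
    qed
    from sum_root_powers_natpermute[OF D0 this, of n "gcd t N" l] D
    have "(\<Sum>xs\<in>natpermute l N. (w ^ t) ^ s xs) =
        (if ?D dvd l then of_nat ((gcd t N + l div ?D - 1) choose (l div ?D)) else 0)"
      by (simp add: N_def s_def)
    moreover have "gcd t N = N div ?D" using D D0 by (metis nonzero_mult_div_cancel_left not_gr_zero)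
    ultimately show ?thesis by (simp add: H_def)
  qed
  have "of_nat N * of_nat (card (weighted_compositions n l i)) =
      (\<Sum>xs\<in>natpermute l N. of_nat N * of_bool (w ^ (s xs + (N - i)) = 1))"
  proof -
    have "w ^ (s xs + (N - i)) = 1 \<longleftrightarrow> s xs mod N = i mod N" for xs
    proof -
      have "w ^ (s xs + (N - i)) = 1 \<longleftrightarrow> (int N dvd int (s xs + (N - i)))"
        using w by (simp only: of_nat_dvd_iff)
      also have "int (s xs + (N - i)) = (int (s xs) - int i) + int N"
        using assms by (simp add: of_nat_diff)
      also have "int N dvd \<dots> \<longleftrightarrow> int (s xs) mod int N = int i mod int N"
        by (simp add: mod_eq_dvd_iff)
      also have "\<dots> \<longleftrightarrow> s xs mod N = i mod N"
        by (simp flip: of_nat_mod)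
      finally show ?thesis .
    qed
    then have "weighted_compositions n l i = {xs \<in> natpermute l N. w ^ (s xs + (N - i)) = 1}"
      by (simp add: weighted_compositions_def N_def s_def)
    then show ?thesis
      by (simp add: of_bool_def sum.If_cases natpermute_finite Int_def flip: sum_distrib_left)
  qed
  also have "\<dots> = (\<Sum>xs\<in>natpermute l N. \<Sum>t<N. (w ^ (s xs + (N - i))) ^ t)"
    using w by (intro sum.cong refl sum_root_powers[OF N0, symmetric]) (simp flip: power_mult)
  also have "\<dots> = (\<Sum>t<N. \<Sum>xs\<in>natpermute l N. (w ^ (s xs + (N - i))) ^ t)"
    by (rule sum.swap)
  also have "\<dots> = (\<Sum>t<N. w ^ (t * (N - i)) * H (N div gcd t N))"
    unfolding F[symmetric] sum_distrib_left
    by (intro sum.cong refl) (simp add: algebra_simps flip: power_mult power_add)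
  also have "\<dots> = (\<Sum>D | D dvd N. \<Sum>t | t < N \<and> N div gcd t N = D. w ^ (t * (N - i)) * H (N div gcd t N))"
  proof (subst sum.group[of "{..<N}" "{D. D dvd N}" "\<lambda>t. N div gcd t N", symmetric])
    show "(\<lambda>t. N div gcd t N) ` {..<N} \<subseteq> {D. D dvd N}"
    proof clarify
      fix t
      have "gcd t N * (N div gcd t N) = N" by simp
      then show "N div gcd t N dvd N" by (metis dvd_triv_right)
    qed
  qed (use N0 in auto)
  also have "\<dots> = (\<Sum>D | D dvd N. c D * H D)"
  proof (rule sum.cong[OF refl])
    fix D assume D: "D \<in> {D. D dvd N}"
    have "(\<Sum>t | t < N \<and> N div gcd t N = D. w ^ (t * (N - i)) * H (N div gcd t N)) =
        (\<Sum>t | t < N \<and> N div gcd t N = D. w ^ (t * (N - i))) * H D"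
      by (simp add: sum_distrib_right)
    also have "\<dots> = c D * H D"
      using ramanujan_sum[of i n D] D assms by (simp add: c_def w_def N_def)
    finally show "(\<Sum>t | t < N \<and> N div gcd t N = D. w ^ (t * (N - i)) * H (N div gcd t N)) = c D * H D" .
  qed
  also have "\<dots> = (\<Sum>D | D dvd gcd N l. c D * H D)"
    by (rule sum.mono_neutral_right) (use N0 in \<open>auto simp: H_def\<close>)
  also have "\<dots> = of_real (\<Sum>D | D dvd gcd N l. (\<Sum>k | k dvd D. of_int (moebius (D div k)) * (real k * of_bool (k dvd i)))
        * real ((N div D + l div D - 1) choose (l div D)))"
    by (simp add: c_def H_def of_real_of_bool)
  finally have "complex_of_real (real N * real (card (weighted_compositions n l i))) = of_real (\<Sum>D | D dvd gcd N l. (\<Sum>k | k dvd D. of_int (moebius (D div k)) * (real k * of_bool (k dvd i)))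
        * real ((N div D + l div D - 1) choose (l div D)))"
    by simp
  then show ?thesis by (simp only: of_real_eq_iff)
qed

text \<open>Absorption rewrites each binomial with upper entry \<open>a + b - 1\<close> as one with
  upper entry \<open>a + b\<close>, at the cost of the factor \<open>N / (N + l)\<close>, which is
  the same for all \<open>D\<close>. Substituting \<open>D = k * k'\<close> then separates the two
  divisor sums.\<close>

lemma card_weighted_compositions:
  fixes n l i :: nat
  assumes "i \<le> n"
  shows "real (card (weighted_compositions n l i)) =
      (\<Sum>k | k dvd gcd (gcd (n + 1) l) i.
         real k / real ((n + 1) + l) *
         (\<Sum>k' | k' dvd gcd ((n + 1) div k) (l div k).
            real_of_int (moebius k') *
            real ((((n + 1) + l) div (k * k')) choose (l div (k * k')))))"
proof -
  define N where "N = n + 1"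
  define g where "g = gcd N l"
  define B where "B D = real (((N + l) div D) choose (l div D))" for D
  have N0: "N > 0" and g0: "g > 0" by (auto simp: N_def g_def)
  have binom: "real ((N div D + l div D - 1) choose (l div D)) = real N / real (N + l) * B D"
    if D: "D dvd g" for D
  proof -
    obtain a b where ab: "N = D * a" "l = D * b" using D by (auto simp: g_def elim!: dvdE)
    have pos: "D > 0" "a > 0" using ab N0 by (auto intro: Nat.gr0I)
    have "N + l = D * (a + b)" using ab by (simp add: algebra_simps)
    then have div: "N div D = a" "l div D = b" "(N + l) div D = a + b"
      using ab pos by simp_all
    have "a * ((a + b) choose b) = (a + b) * ((a + b - 1) choose b)"
      using binomial_absorb_comp[of "a + b" b] by simp
    then have "real a * real ((a + b) choose b) = real (a + b) * real ((a + b - 1) choose b)"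
      by (metis of_nat_mult)
    then have "real ((a + b - 1) choose b) = real a / real (a + b) * real ((a + b) choose b)"
      using pos by (simp add: nonzero_eq_divide_eq mult.commute)
    moreover have "real a / real (a + b) = real N / real (N + l)"
      using ab pos by (simp flip: distrib_left)
    ultimately show ?thesis by (simp only: div B_def)
  qed
  have "real N * real (card (weighted_compositions n l i)) =
      (\<Sum>D | D dvd g. \<Sum>k | k dvd D \<and> k dvd i. real k * real_of_int (moebius (D div k)) * (real N / real (N + l) * B D))"
    unfolding N_def card_weighted_compositions_ramanujan[OF assms] unfolding N_def[symmetric] g_def[symmetric]
  proof (rule sum.cong[OF refl])
    fix D assume D: "D \<in> {D. D dvd g}"
    then have "D > 0" using g0 by (auto intro: Nat.gr0I)
    then have "(\<Sum>k | k dvd D. of_int (moebius (D div k)) * (real k * of_bool (k dvd i))) =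
       (\<Sum>k | k dvd D \<and> k dvd i. real k * real_of_int (moebius (D div k)))"
      by (intro sum.mono_neutral_cong_right) auto
    then show "(\<Sum>k | k dvd D. of_int (moebius (D div k)) * (real k * of_bool (k dvd i)))
        * real ((N div D + l div D - 1) choose (l div D)) =
        (\<Sum>k | k dvd D \<and> k dvd i. real k * real_of_int (moebius (D div k)) * (real N / real (N + l) * B D))"
      using D binom[of D] by (simp only: sum_distrib_right mem_Collect_eq)
  qed
  also have "\<dots> = (\<Sum>(D, k)\<in>Sigma {D. D dvd g} (\<lambda>D. {k. k dvd D \<and> k dvd i}). real k * real_of_int (moebius (D div k)) * (real N / real (N + l) * B D))"
    by (rule sum.Sigma) (use g0 in \<open>auto simp: dvd_pos_nat\<close>)
  also have "\<dots> = (\<Sum>(k, k')\<in>Sigma {k. k dvd gcd g i} (\<lambda>k. {k'. k' dvd g div k}). real k * real_of_int (moebius k') * (real N / real (N + l) * B (k * k')))"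
  proof (rule sum.reindex_bij_witness[of _ "\<lambda>(k, k'). (k * k', k)" "\<lambda>(D, k). (k, D div k)"], goal_cases)
    case (4 b)
    then obtain k k' where b: "b = (k, k')" "k dvd g" "k dvd i" "k' dvd g div k" by auto
    then have "k * k' dvd g" by (metis dvd_mult_div_cancel mult_dvd_mono dvd_refl)
    then show ?case using b by auto
  next
    case (3 b)
    then obtain k k' where b: "b = (k, k')" "k dvd g" by auto
    then have "k > 0" using g0 by (auto intro: Nat.gr0I)
    then show ?case using b by simp
  qed (auto intro: dvd_trans div_dvd_div[THEN iffD2])
  also have "\<dots> = (\<Sum>k | k dvd gcd g i. \<Sum>k' | k' dvd g div k. real k * real_of_int (moebius k') * (real N / real (N + l) * B (k * k')))"
    by (rule sum.Sigma[symmetric]) (use g0 in \<open>auto simp: dvd_div_eq_0_iff dest: dvd_div_eq_0_iff[THEN iffD1]\<close>)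
  also have "\<dots> = real N * (\<Sum>k | k dvd gcd g i. real k / real (N + l) * (\<Sum>k' | k' dvd g div k. real_of_int (moebius k') * B (k * k')))"
    by (simp add: sum_distrib_left mult_ac)
  also have "\<dots> = real N * (\<Sum>k | k dvd gcd g i. real k / real (N + l) * (\<Sum>k' | k' dvd gcd (N div k) (l div k). real_of_int (moebius k') * B (k * k')))"
  proof -
    have "g div k = gcd (N div k) (l div k)" if "k dvd gcd g i" for k
    proof -
      have k: "k dvd N" "k dvd l" using that by (auto simp: g_def)
      then have "k > 0" using N0 by (auto intro: Nat.gr0I)
      moreover have "k * gcd (N div k) (l div k) = g"
        using k by (simp add: g_def gcd_mult_distrib_nat)
      ultimately show ?thesis by (metis nonzero_mult_div_cancel_left not_gr_zero)
    qed
    then show ?thesis by simp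
  qed
  finally show ?thesis using N0 by (simp add: N_def g_def B_def)
qed

section \<open>The Laplacian of a cycle\<close>

lemma mod_plus_one_le: "m mod (n + 1) \<le> (n::nat)"
  using mod_less_divisor[of "n + 1" m] by linarith

text \<open>Adding \<open>n\<close> modulo \<open>n + 1\<close> is the cyclic predecessor, written
  without subtraction below zero.\<close>

lemma cyclic_neighbours:
  fixes i j n :: nat
  assumes "i \<le> n" "j \<le> n"
  shows "i = (j + 1) mod (n + 1) \<longleftrightarrow> j = (i + n) mod (n + 1)"
proof -
  have "i = (j + 1) mod (n + 1) \<longleftrightarrow> (if j = n then i = 0 else i = j + 1)"
    using assms by auto
  moreover have "j = (i + n) mod (n + 1) \<longleftrightarrow> (if i = 0 then j = n else j = i - 1)"
  proof (cases "i = 0")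
    case False
    then have "i + n = (i - 1) + (n + 1)" by simp
    then have "(i + n) mod (n + 1) = (i - 1) mod (n + 1)" by (metis mod_add_self2)
    then show ?thesis using False assms by simp
  qed simp
  ultimately show ?thesis using assms by auto
qed

lemma cartan_A_sym: "cartan_A n i j = cartan_A n j i"
  by (simp add: cartan_A_def eq_commute)

text \<open>The Cartan matrix acts as the negative discrete Laplacian of the cycle. For
  \<open>n = 1\<close> the two neighbours coincide and are counted twice.\<close>

lemma sum_cartan_A:
  assumes "i \<le> n"
  shows "(\<Sum>j\<le>n. g j * cartan_A n i j) = 2 * g i - g ((i + 1) mod (n + 1)) - g ((i + n) mod (n + 1))"
proof -
  have "(\<Sum>j\<le>n. g j * cartan_A n i j) =
     (\<Sum>j\<le>n. (if j = i then 2 * g j else 0) - (if j = (i + 1) mod (n + 1) then g j else 0)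
       - (if j = (i + n) mod (n + 1) then g j else 0))"
    by (rule sum.cong[OF refl]) (use assms cyclic_neighbours in \<open>auto simp: cartan_A_def\<close>)
  also have "\<dots> = 2 * g i - g ((i + 1) mod (n + 1)) - g ((i + n) mod (n + 1))"
    using assms mod_plus_one_le[of _ n] by (simp add: sum_subtractf)
  finally show ?thesis .
qed

lemma sum_cartan_A_const: "i \<le> n \<Longrightarrow> (\<Sum>j\<le>n. cartan_A n i j) = 0"
  using sum_cartan_A[of i n "\<lambda>_. 1"] by simp

text \<open>Maximum principle: where \<open>u\<close> equals its upper bound \<open>M\<close>,
  subharmonicity forces the neighbours to equal \<open>M\<close> too, and this value propagates
  around the cycle. Subharmonicity is asked for only where the bound is attained, so that it can be
  applied to a function known to be subharmonic only where it is positive.\<close>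

lemma subharmonic_on_cycle_constant:
  fixes u :: "nat \<Rightarrow> int"
  assumes max: "\<And>j. j \<le> n \<Longrightarrow> u j \<le> M" and "i \<le> n" "u i = M"
    and sub: "\<And>j. j \<le> n \<Longrightarrow> u j = M \<Longrightarrow> (\<Sum>s\<le>n. u s * cartan_A n j s) \<le> 0"
    and "j \<le> n"
  shows "u j = M"
proof -
  have "u ((i + t) mod (n + 1)) = M" for t
  proof (induction t)
    case 0
    then show ?case using assms by simp
  next
    case (Suc t)
    let ?j = "(i + t) mod (n + 1)"
    have j: "?j \<le> n" by (rule mod_plus_one_le)
    have "u ((?j + 1) mod (n + 1)) \<le> M" "u ((?j + n) mod (n + 1)) \<le> M"
      by (rule max, rule mod_plus_one_le)+
    then have "u ((?j + 1) mod (n + 1)) = M"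
      using sub[OF j Suc] sum_cartan_A[OF j, of u] Suc by linarith
    then show ?case by (simp add: mod_simps)
  qed
  \<comment> \<open>The extra full turn keeps the number of steps a genuine difference when
    \<open>j < i\<close>.\<close>
  from this[of "j + (n + 1) - i"] have "u ((j + (n + 1)) mod (n + 1)) = M"
    using assms by simp
  then show ?thesis using assms by (simp only: mod_add_self2) simp
qed

lemma harmonic_on_cycle_constant:
  fixes u :: "nat \<Rightarrow> int"
  assumes "\<And>i. i \<le> n \<Longrightarrow> (\<Sum>s\<le>n. u s * cartan_A n i s) = 0" and "j \<le> n"
  shows "u j = u 0"
proof -
  define M where "M = Max (u ` {..n})"
  have max: "u j \<le> M" if "j \<le> n" for j using that by (simp add: M_def)
  have "M \<in> u ` {..n}" unfolding M_def by (rule Max_in) auto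
  then obtain i where i: "i \<le> n" "u i = M" by auto
  have "u j = M" if "j \<le> n" for j
    by (rule subharmonic_on_cycle_constant[of n u M i]) (use max i assms(1) that in auto)
  then show ?thesis using assms(2) by simp
qed

text \<open>The double partial sums of \<open>c\<close> solve the second-order recurrence up to a
  linear term, and divisibility by \<open>n + 1\<close> makes the slope that closes the solution up
  around the cycle an integer. The vanishing entry of \<open>k\<close> will express maximality of
  the weight: adding the null root would make that coefficient negative.\<close>

lemma cartan_A_solvable:
  fixes c :: "nat \<Rightarrow> int"
  assumes "1 \<le> n" and sum0: "(\<Sum>j\<le>n. c j) = 0" and "int (n + 1) dvd (\<Sum>j\<le>n. int j * c j)"
  obtains k :: "nat \<Rightarrow> nat" where "\<And>i. i \<le> n \<Longrightarrow> (\<Sum>j\<le>n. int (k j) * cartan_A n i j) = c i"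
    and "\<exists>j\<le>n. k j = 0"
proof -
  obtain a where a: "(\<Sum>j\<le>n. int j * c j) = int (n + 1) * a" using assms(3) by blast
  define x where "x j = (\<Sum>s=1..j. (int j - int s) * c s)" for j
  \<comment> \<open>The slope \<open>- a - c 0\<close> is the one for which
    \<open>u (Suc n) = u 0 = 0\<close>.\<close>
  define u where "u j = - int j * a - int j * c 0 - x j" for j
  have x_Suc: "x (Suc j) = x j + (\<Sum>s=1..j. c s)" for j
  proof -
    have "x (Suc j) = (\<Sum>s=1..j. (int j - int s) * c s + c s)"
      by (auto simp: x_def algebra_simps)
    then show ?thesis by (simp add: x_def sum.distrib)
  qed
  have x0: "x 0 = 0" by (simp add: x_def)
  have split: "(\<Sum>j\<le>n. g j) = g 0 + (\<Sum>s=1..n. g s)" for g :: "nat \<Rightarrow> int"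
    by (simp add: sum.atLeast_Suc_atMost atMost_atLeast0)
  have S: "(\<Sum>s=1..n. c s) = - c 0" using split[of c] sum0 by simp
  have T: "(\<Sum>s=1..n. int s * c s) = int (n + 1) * a" using split[of "\<lambda>j. int j * c j"] a by simp
  have "x (Suc n) = int (n + 1) * (\<Sum>s=1..n. c s) - (\<Sum>s=1..n. int s * c s)"
    by (simp add: x_def algebra_simps sum_subtractf sum.distrib sum_distrib_left)
  also have "\<dots> = - int (n + 1) * c 0 - int (n + 1) * a"
    unfolding S T by (simp add: algebra_simps)
  finally have uN: "u (Suc n) = 0" by (simp add: u_def algebra_simps)
  have u0: "u 0 = 0" by (simp add: u_def x0)
  have inner: "2 * u (Suc j) - u (Suc (Suc j)) - u j = c (Suc j)" for j
    by (simp add: u_def x_Suc algebra_simps)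
  have sol: "(\<Sum>j\<le>n. u j * cartan_A n i j) = c i" if i: "i \<le> n" for i
  proof (cases i)
    case 0
    have "u n = - (u (Suc n) - u n)" using uN by simp
    also have "\<dots> = a + c 0 + (\<Sum>s=1..n. c s)" by (simp add: u_def x_Suc algebra_simps)
    also have "\<dots> = a" using split[of c] sum0 by simp
    finally have "u n = a" .
    moreover have "u 1 = - a - c 0" by (simp add: u_def x_def)
    ultimately show ?thesis using sum_cartan_A[OF i, of u] 0 u0 assms(1) by simp
  next
    case (Suc j)
    have "i + n = j + (n + 1)" using Suc by simp
    then have "(i + n) mod (n + 1) = j" using Suc i by (simp only: mod_add_self2) simp
    moreover have "u ((i + 1) mod (n + 1)) = u (Suc (Suc j))"
      using Suc i u0 uN by (cases "i = n") auto
    ultimately show ?thesis using sum_cartan_A[OF i, of u] inner[of j] Suc by simp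
  qed
  \<comment> \<open>Constants lie in the kernel of the Cartan matrix, so subtracting the minimum
    gives a nonnegative solution with a zero.\<close>
  define M where "M = Min (u ` {..n})"
  define k where "k j = nat (u j - M)" for j
  have min: "M \<le> u j" if "j \<le> n" for j using that by (simp add: M_def)
  have "M \<in> u ` {..n}" unfolding M_def by (rule Min_in) auto
  then obtain i0 where "i0 \<le> n" "u i0 = M" by auto
  then have "\<exists>j\<le>n. k j = 0" by (auto simp: k_def)
  moreover have "(\<Sum>j\<le>n. int (k j) * cartan_A n i j) = c i" if i: "i \<le> n" for i
  proof -
    have "(\<Sum>j\<le>n. int (k j) * cartan_A n i j) = (\<Sum>j\<le>n. u j * cartan_A n i j - M * cartan_A n i j)"
      by (rule sum.cong[OF refl]) (use min in \<open>auto simp: k_def algebra_simps\<close>)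
    also have "\<dots> = (\<Sum>j\<le>n. u j * cartan_A n i j) - M * (\<Sum>j\<le>n. cartan_A n i j)"
      by (simp add: sum_subtractf sum_distrib_left)
    finally show ?thesis using sol[OF i] sum_cartan_A_const[OF i] by simp
  qed
  ultimately show ?thesis using that by blast
qed

text \<open>Subtracting simple roots does not change the level, since the columns of the Cartan
  matrix sum to zero.\<close>

lemma sum_sum_cartan_A: "(\<Sum>i\<le>n. \<Sum>j\<le>n. k j * cartan_A n i j) = 0"
proof -
  have "(\<Sum>i\<le>n. \<Sum>j\<le>n. k j * cartan_A n i j) = (\<Sum>j\<le>n. k j * (\<Sum>i\<le>n. cartan_A n j i))"
    by (subst sum.swap) (simp only: sum_distrib_left cartan_A_sym)
  then show ?thesis by (simp add: sum_cartan_A_const)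
qed

text \<open>Subtracting simple roots preserves the weighted label sum modulo \<open>n + 1\<close>:
  the function \<open>j\<close> is linear on the cycle except for a jump by
  \<open>n + 1\<close>.\<close>

lemma dvd_weighted_sum_cartan_A:
  "int (n + 1) dvd (\<Sum>i\<le>n. int i * (\<Sum>j\<le>n. k j * cartan_A n i j))"
proof -
  have "(\<Sum>i\<le>n. int i * (\<Sum>j\<le>n. k j * cartan_A n i j)) = (\<Sum>j\<le>n. k j * (\<Sum>i\<le>n. int i * cartan_A n j i))"
    unfolding sum_distrib_left by (subst sum.swap) (simp only: cartan_A_sym mult.left_commute)
  moreover have "int (n + 1) dvd (\<Sum>i\<le>n. int i * cartan_A n j i)" if "j \<le> n" for j
  proof -
    have *: "int (a mod (n + 1)) = int a - int (n + 1) * int (a div (n + 1))" for a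
      by (metis mult_div_mod_eq of_nat_add of_nat_mult add_diff_cancel_left')
    have "2 * int j - int ((j + 1) mod (n + 1)) - int ((j + n) mod (n + 1)) =
        int (n + 1) * (int ((j + 1) div (n + 1)) + int ((j + n) div (n + 1)) - 1)"
      unfolding * by (simp add: algebra_simps)
    then show ?thesis by (simp add: sum_cartan_A[OF that])
  qed
  ultimately show ?thesis by (simp only:) (rule dvd_sum, simp only: atMost_iff dvd_mult)
qed

section \<open>Weights of highest weight modules\<close>

context affine_A_datum
begin

definition lower :: "('h \<Rightarrow> complex) \<Rightarrow> (nat \<Rightarrow> nat) \<Rightarrow> 'h \<Rightarrow> complex" where
  "lower \<phi> k h = \<phi> h - (\<Sum>j\<le>n. of_nat (k j) * \<alpha> j h)"

lemma linear_functional_iff: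
  "Vector_Spaces.linear sh (*) \<phi> \<longleftrightarrow> (\<forall>x y. \<phi> (x + y) = \<phi> x + \<phi> y) \<and> (\<forall>c x. \<phi> (sh c x) = c * \<phi> x)"
  using H.vector_space_axioms root_linear[of 0] by (auto simp: Vector_Spaces.linear_iff)

lemma linear_lower:
  assumes "Vector_Spaces.linear sh (*) \<phi>"
  shows "Vector_Spaces.linear sh (*) (lower \<phi> k)"
proof -
  have "\<alpha> j (x + y) = \<alpha> j x + \<alpha> j y" "\<alpha> j (sh c x) = c * \<alpha> j x" if "j \<le> n" for j c x y
    using root_linear[OF that] by (simp_all add: linear_functional_iff)
  then show ?thesis
    using assms by (simp add: linear_functional_iff lower_def algebra_simps sum.distrib sum_distrib_left)
qed

text \<open>Evaluation at the coroots shows that \<open>c\<close> is harmonic on the cycle, so only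
  a multiple of the null root could vanish. Evaluation at \<open>d\<close>, where only the root of
  node 0 is nonzero, excludes that as well.\<close>

lemma roots_independent:
  fixes c :: "nat \<Rightarrow> int"
  assumes eq: "\<And>h. (\<Sum>j\<le>n. of_int (c j) * \<alpha> j h) = 0" and "j \<le> n"
  shows "c j = 0"
proof -
  have const: "c s = c 0" if "s \<le> n" for s
  proof (rule harmonic_on_cycle_constant[OF _ that])
    fix i assume i: "i \<le> n"
    have "complex_of_int (\<Sum>s\<le>n. c s * cartan_A n i s) = (\<Sum>j\<le>n. of_int (c j) * \<alpha> j (hc i))"
      using i by (simp add: root_coroot)
    then show "(\<Sum>s\<le>n. c s * cartan_A n i s) = 0" using eq by (simp only: of_int_eq_0_iff)
  qed
  have "(\<Sum>j\<le>n. of_int (c j) * \<alpha> j d) = (\<Sum>j\<le>n. if j = 0 then of_int (c j) else 0 :: complex)"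
    by (rule sum.cong) (auto simp: root_d)
  then have "c 0 = 0" using eq[of d] by simp
  then show ?thesis using const[OF assms(2)] by simp
qed

lemma lower_eq_iff: "lower \<phi> k = lower \<phi> k' \<longleftrightarrow> (\<forall>j\<le>n. k j = k' j)"
proof
  assume eq: "lower \<phi> k = lower \<phi> k'"
  have "(\<Sum>j\<le>n. of_int (int (k j) - int (k' j)) * \<alpha> j h) = 0" for h
    using fun_cong[OF eq, of h] by (simp add: lower_def algebra_simps sum_subtractf)
  from roots_independent[OF this] show "\<forall>j\<le>n. k j = k' j" by fastforce
qed (auto simp: lower_def)

lemma lower_0 [simp]: "lower \<phi> (\<lambda>_. 0) = \<phi>"
  by (auto simp: lower_def)

lemma lower_Suc:
  assumes "i \<le> n"
  shows "lower \<phi> (k(i := Suc (k i))) h = lower \<phi> k h - \<alpha> i h"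
proof -
  have "(\<Sum>j\<le>n. of_nat ((k(i := Suc (k i))) j) * \<alpha> j h) = (\<Sum>j\<le>n. of_nat (k j) * \<alpha> j h + (if j = i then \<alpha> j h else 0))"
    by (rule sum.cong) (auto simp: algebra_simps)
  then show ?thesis using assms by (simp add: lower_def sum.distrib)
qed

lemma lower_hc:
  assumes "\<phi> (hc i) = of_int m" "i \<le> n"
  shows "lower \<phi> k (hc i) = of_int (m - (\<Sum>j\<le>n. int (k j) * cartan_A n i j))"
  using assms by (simp add: lower_def root_coroot)

lemma lower_plus_null_root: "lower \<phi> (\<lambda>j. Suc (k j)) h + null_root n \<alpha> h = lower \<phi> k h"
  by (simp add: lower_def null_root_def algebra_simps sum.distrib)

text \<open>The definite description is meaningful: prescribing values on the independent set of
  coroots and \<open>d\<close> gives existence, and its spanning gives uniqueness.\<close>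

lemma fundamental_weight_props:
  assumes "i \<le> n"
  shows "Vector_Spaces.linear sh (*) (fundamental_weight sh n hc d i)"
    and "\<And>j. j \<le> n \<Longrightarrow> fundamental_weight sh n hc d i (hc j) = of_bool (i = j)"
proof -
  let ?P = "\<lambda>\<phi>. Vector_Spaces.linear sh (*) \<phi> \<and> (\<forall>j\<le>n. \<phi> (hc j) = of_bool (i = j)) \<and> \<phi> d = 0"
  interpret F: vector_space_pair sh "(*) :: complex \<Rightarrow> complex \<Rightarrow> complex"
    using root_linear[of 0] by (simp add: vector_space_pair_def Vector_Spaces.linear_iff)
  obtain \<phi> where \<phi>: "Vector_Spaces.linear sh (*) \<phi>"
      "\<And>x. x \<in> insert d (hc ` {..n}) \<Longrightarrow> \<phi> x = of_bool (x = hc i)"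
    using F.linear_independent_extend[OF basis_independent, of "\<lambda>x. of_bool (x = hc i)"] by blast
  have "d \<noteq> hc i" using d_notin_coroots assms by blast
  moreover have "hc j = hc i \<longleftrightarrow> i = j" if "j \<le> n" for j
    using inj_on_eq_iff[OF coroots_inj, of j i] that assms by auto
  ultimately have "?P \<phi>" using \<phi> by simp
  moreover have "\<psi> = \<phi>" if "?P \<psi>" for \<psi>
  proof
    fix x
    show "\<psi> x = \<phi> x"
      by (rule F.linear_eq_on[of \<psi> \<phi> x "insert d (hc ` {..n})"]) 
        (use that \<open>?P \<phi>\<close> basis_span in auto)
  qed
  ultimately have "?P (fundamental_weight sh n hc d i)"
    unfolding fundamental_weight_def by (rule theI)
  then show "Vector_Spaces.linear sh (*) (fundamental_weight sh n hc d i)"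
    and "\<And>j. j \<le> n \<Longrightarrow> fundamental_weight sh n hc d i (hc j) = of_bool (i = j)" by auto
qed

end

section \<open>Weight vectors and the action of the generators\<close>

context lie_module
begin

lemma action_simps:
  "\<rho> x (v + w) = \<rho> x v + \<rho> x w" "\<rho> x (sv c v) = sv c (\<rho> x v)"
  "\<rho> (x + y) v = \<rho> x v + \<rho> y v" "\<rho> (sg c x) v = sv c (\<rho> x v)"
  using action_linear action_linear_left unfolding Vector_Spaces.linear_iff by blast+

lemma action_0 [simp]: "\<rho> x 0 = 0" "\<rho> 0 v = 0"
  using action_simps(1)[of x 0 0] action_simps(3)[of 0 0 v] by simp_all

lemma action_sum: "\<rho> x (sum g A) = (\<Sum>a\<in>A. \<rho> x (g a))"
  by (induction A rule: infinite_finite_induct) (simp_all add: action_simps)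

end

context irreducible_hw_module
begin

abbreviation wspace :: "('h \<Rightarrow> complex) \<Rightarrow> 'v set" where
  "wspace \<equiv> weight_space sv \<iota> \<rho>"

abbreviation wts :: "('h \<Rightarrow> complex) set" where
  "wts \<equiv> weights sh sv \<iota> \<rho>"

lemma wspaceD: "v \<in> wspace \<mu> \<Longrightarrow> \<rho> (\<iota> h) v = sv (\<mu> h) v"
  by (simp add: weight_space_def)

lemma weights_nonzero_vector:
  assumes "\<mu> \<in> wts"
  obtains w where "w \<noteq> 0" "w \<in> wspace \<mu>"
proof -
  have "0 \<in> wspace \<mu>" by (simp add: weight_space_def)
  moreover have "wspace \<mu> \<noteq> {0}" using assms by (simp add: weights_def)
  ultimately show thesis using that by blast
qed

lemma scale_in_wspace: "v \<in> wspace \<mu> \<Longrightarrow> sv c v \<in> wspace \<mu>"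
  by (simp add: weight_space_def action_simps mult.commute)

lemma e_wspace:
  assumes "i \<le> n" "v \<in> wspace \<mu>"
  shows "\<rho> (e i) v \<in> wspace (\<lambda>h. \<mu> h + \<alpha> i h)"
proof -
  have "\<rho> (\<iota> h) (\<rho> (e i) v) = sv (\<mu> h + \<alpha> i h) (\<rho> (e i) v)" for h
    using action_bracket[of "\<iota> h" "e i" v] assms(1)
    by (simp add: bracket_h_e wspaceD[OF assms(2)] action_simps V.scale_left_distrib algebra_simps)
  then show ?thesis by (simp add: weight_space_def)
qed

lemma f_wspace:
  assumes "i \<le> n" "v \<in> wspace \<mu>"
  shows "\<rho> (f i) v \<in> wspace (\<lambda>h. \<mu> h - \<alpha> i h)"
proof -
  have "\<rho> (\<iota> h) (\<rho> (f i) v) = sv (\<mu> h - \<alpha> i h) (\<rho> (f i) v)" for h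
    using action_bracket[of "\<iota> h" "f i" v] assms(1)
    by (simp add: bracket_h_f wspaceD[OF assms(2)] action_simps V.scale_left_diff_distrib algebra_simps
        del: L.scale_minus_left)
  then show ?thesis by (simp add: weight_space_def)
qed

text \<open>Some \<open>h\<close> separates \<open>\<nu> b\<close> from \<open>\<mu>\<close>. The
  operator \<open>\<rho> (\<iota> h)\<close> minus the scalar \<open>\<nu> b h\<close> kills the
  summand at \<open>b\<close> and multiplies the whole sum by a nonzero scalar, so induction applies
  to the remaining summands. The weights \<open>\<nu> a\<close> may repeat, as those of different
  words in the \<open>f j\<close> do.\<close>

lemma sum_weight_vectors_eq_0:
  assumes "finite A" "\<And>a. a \<in> A \<Longrightarrow> g a \<in> wspace (\<nu> a)" "\<And>a. a \<in> A \<Longrightarrow> \<nu> a \<noteq> \<mu>"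
    and "sum g A \<in> wspace \<mu>"
  shows "sum g A = 0"
  using assms
proof (induction A arbitrary: g rule: finite_induct)
  case (insert b A)
  let ?x = "sum g (insert b A)"
  obtain h where h: "\<nu> b h \<noteq> \<mu> h" using insert.prems(2)[of b] by fastforce
  let ?c = "\<mu> h - \<nu> b h"
  have "sv ?c ?x = \<rho> (\<iota> h) ?x - sv (\<nu> b h) ?x"
    by (simp only: wspaceD[OF insert.prems(3)] V.scale_left_diff_distrib)
  also have "\<dots> = (\<Sum>a\<in>insert b A. sv (\<nu> a h - \<nu> b h) (g a))"
    by (simp only: action_sum V.scale_sum_right V.scale_left_diff_distrib flip: sum_subtractf)
      (rule sum.cong, auto simp: wspaceD[OF insert.prems(1)])
  also have "\<dots> = (\<Sum>a\<in>A. sv (\<nu> a h - \<nu> b h) (g a))"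
    using insert.hyps by simp
  finally have eq: "sv ?c ?x = (\<Sum>a\<in>A. sv (\<nu> a h - \<nu> b h) (g a))" .
  have "(\<Sum>a\<in>A. sv (\<nu> a h - \<nu> b h) (g a)) = 0"
  proof (rule insert.IH)
    show "(\<Sum>a\<in>A. sv (\<nu> a h - \<nu> b h) (g a)) \<in> wspace \<mu>"
      unfolding eq[symmetric] by (rule scale_in_wspace[OF insert.prems(3)])
  qed (use insert.prems in \<open>auto intro: scale_in_wspace\<close>)
  then show ?case using eq h by simp
qed simp

text \<open>Words in the \<open>f j\<close> are weight vectors, which gives stability under the
  Cartan part; an \<open>e i\<close> is commuted to the right until it kills \<open>v\<close>. Since
  the elements preserving \<open>W\<close> form a subalgebra, the generators suffice.\<close>

lemma span_f_words_submodule: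
  assumes v: "v \<in> wspace \<Lambda>" "\<And>i. i \<le> n \<Longrightarrow> \<rho> (e i) v = 0"
  defines "W \<equiv> V.span ((\<lambda>js. foldr (\<lambda>j. \<rho> (f j)) js v) ` lists {..n})"
  shows "submodule W"
proof -
  define word where "word js = foldr (\<lambda>j. \<rho> (f j)) js v" for js
  have W: "W = V.span (word ` lists {..n})" by (simp add: W_def word_def)
  have word_W: "word js \<in> W" if "js \<in> lists {..n}" for js
    unfolding W by (rule V.span_base) (use that in blast)
  have word_wt: "\<exists>\<mu>. word js \<in> wspace \<mu>" if "js \<in> lists {..n}" for js
    using that
  proof (induction js)
    case Nil
    then show ?case using v by (auto simp: word_def)
  next
    case (Cons j js)
    then obtain \<mu> where "word js \<in> wspace \<mu>" by auto
    then show ?case using f_wspace[of j "word js" \<mu>] Cons by (auto simp: word_def)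
  qed
  have extend: "\<rho> x w \<in> W" if x: "\<And>js. js \<in> lists {..n} \<Longrightarrow> \<rho> x (word js) \<in> W" and w: "w \<in> W" for x w
    using w unfolding W
  proof (induction rule: V.span_induct_alt)
    case base
    then show ?case by (simp add: V.span_zero)
  next
    case (step c b y)
    then show ?case using x unfolding W
      by (auto simp: action_simps intro!: V.span_add V.span_scale)
  qed
  have f: "\<rho> (f i) w \<in> W" if "i \<le> n" "w \<in> W" for i w
  proof (rule extend[OF _ that(2)])
    fix js assume "js \<in> lists {..n}"
    then show "\<rho> (f i) (word js) \<in> W" using word_W[of "i # js"] that by (simp add: word_def)
  qed
  have h: "\<rho> (\<iota> h) w \<in> W" if "w \<in> W" for h w
  proof (rule extend[OF _ that])
    fix js assume js: "js \<in> lists {..n}"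
    then obtain \<mu> where "word js \<in> wspace \<mu>" using word_wt by blast
    then show "\<rho> (\<iota> h) (word js) \<in> W"
      using word_W[OF js] by (simp add: wspaceD W V.span_scale)
  qed
  have e_word: "\<rho> (e i) (word js) \<in> W" if "i \<le> n" "js \<in> lists {..n}" for i js
    using that(2)
  proof (induction js)
    case Nil
    then show ?case using v that by (simp add: word_def W V.span_zero)
  next
    case (Cons j js)
    have "\<rho> (e i) (word (j # js)) = \<rho> (br (e i) (f j)) (word js) + \<rho> (f j) (\<rho> (e i) (word js))"
      by (simp add: word_def action_bracket)
    moreover have "\<rho> (br (e i) (f j)) (word js) \<in> W"
      using Cons that h word_W by (auto simp: bracket_e_f W V.span_zero)
    moreover have "\<rho> (f j) (\<rho> (e i) (word js)) \<in> W" using Cons f by auto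
    ultimately show ?case unfolding W by (simp add: V.span_add)
  qed
  have e: "\<rho> (e i) w \<in> W" if "i \<le> n" "w \<in> W" for i w
    using extend[OF _ that(2)] e_word[OF that(1)] by blast
  have "subalgebra {x. \<forall>w\<in>W. \<rho> x w \<in> W}"
    unfolding subalgebra_def L.subspace_def W
    by (auto simp: action_simps action_bracket V.span_zero V.span_add V.span_scale V.span_diff)
  then have "subalgebra hull (range \<iota> \<union> e ` {..n} \<union> f ` {..n}) \<subseteq> {x. \<forall>w\<in>W. \<rho> x w \<in> W}"
    by (intro hull_minimal) (use e f h in auto)
  then have "\<forall>x. \<forall>w\<in>W. \<rho> x w \<in> W" using generated by auto
  then show ?thesis by (auto simp: submodule_def W)
qed

lemma highest_weight_is_weight: "\<Lambda> \<in> wts"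
  using highest_weight highest_weight_vector by (auto simp: weights_def)

text \<open>By irreducibility of the generation from \<open>v\<close>, the words in the
  \<open>f j\<close> span the module, and the word \<open>js\<close> has weight
  \<open>lower \<Lambda> (count_list js)\<close>. A nonzero vector of weight \<open>\<mu>\<close> is
  a finite combination of words, and it would vanish if none of them had weight
  \<open>\<mu>\<close>.\<close>

lemma weights_le_highest:
  assumes "\<mu> \<in> wts"
  obtains k where "\<mu> = lower \<Lambda> k"
proof -
  obtain v where v: "v \<in> wspace \<Lambda>" "\<forall>x \<in> subalgebra hull (e ` {..n}). \<rho> x v = 0"
    "submodule hull {v} = UNIV" using highest_weight_vector by blast
  define word where "word js = foldr (\<lambda>j. \<rho> (f j)) js v" for js
  have word_wt: "word js \<in> wspace (lower \<Lambda> (count_list js))" if "js \<in> lists {..n}" for js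
    using that
  proof (induction js)
    case Nil
    have "count_list [] = (\<lambda>_::nat. 0)" by auto
    then show ?case using v by (simp add: word_def)
  next
    case (Cons j js)
    have "count_list (j # js) = (count_list js)(j := Suc (count_list js j))" by auto
    moreover have "lower \<Lambda> ((count_list js)(j := Suc (count_list js j))) = (\<lambda>h. lower \<Lambda> (count_list js) h - \<alpha> j h)"
      using Cons by (auto simp: lower_Suc)
    moreover have "\<rho> (f j) (word js) \<in> wspace (\<lambda>h. lower \<Lambda> (count_list js) h - \<alpha> j h)"
      using f_wspace[of j "word js"] Cons by simp
    ultimately show ?case by (simp only: word_def foldr.simps o_apply)
  qed
  have ev: "\<rho> (e i) v = 0" if "i \<le> n" for i
    using v(2) that by (auto intro: hull_inc)
  have "submodule (V.span (word ` lists {..n}))"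
    unfolding word_def by (rule span_f_words_submodule[OF v(1) ev])
  moreover have "word [] \<in> V.span (word ` lists {..n})" by (rule V.span_base) auto
  then have "v \<in> V.span (word ` lists {..n})" by (simp add: word_def)
  ultimately have span: "V.span (word ` lists {..n}) = UNIV"
    using hull_minimal[of "{v}" _ submodule] v(3) by auto
  obtain w where w: "w \<noteq> 0" "w \<in> wspace \<mu>"
    using assms by (rule weights_nonzero_vector)
  have "w \<in> V.span (word ` lists {..n})" using span by simp
  then obtain T r where T: "finite T" "T \<subseteq> word ` lists {..n}" "w = (\<Sum>a\<in>T. sv (r a) a)"
    unfolding V.span_explicit by blast
  have "\<forall>a\<in>T. \<exists>js \<in> lists {..n}. a = word js" using T by auto
  then obtain js where js: "\<And>a. a \<in> T \<Longrightarrow> js a \<in> lists {..n}" "\<And>a. a \<in> T \<Longrightarrow> a = word (js a)"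
    by metis
  have "\<exists>a\<in>T. lower \<Lambda> (count_list (js a)) = \<mu>"
  proof (rule ccontr)
    assume neg: "\<not> ?thesis"
    have "(\<Sum>a\<in>T. sv (r a) a) = 0"
    proof (rule sum_weight_vectors_eq_0[OF T(1), of _ "\<lambda>a. lower \<Lambda> (count_list (js a))" \<mu>])
      fix a assume a: "a \<in> T"
      then show "sv (r a) a \<in> wspace (lower \<Lambda> (count_list (js a)))"
        using word_wt[OF js(1)[OF a]] js(2)[OF a] scale_in_wspace by simp
    qed (use neg w T in auto)
    then show False using w T by simp
  qed
  then show thesis using that by blast
qed

text \<open>
  If \<open>f i\<close> killed a vector of positive \<open>hc i\<close>-weight, it would be a lowest weight vector for
  the \<open>\<ss>\<ll>\<^sub>2\<close> of node \<open>i\<close>, and no power of \<open>e i\<close> could kill it; but \<open>e i\<close> acts locally nilpotently.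
\<close>

lemma weight_minus_root:
  assumes "i \<le> n" and wt: "lower \<Lambda> k \<in> wts" and p: "lower \<Lambda> k (hc i) = of_int p" "p > 0"
  shows "lower \<Lambda> (k(i := Suc (k i))) \<in> wts"
proof -
  obtain w where w: "w \<noteq> 0" "w \<in> wspace (lower \<Lambda> k)"
    using wt by (rule weights_nonzero_vector)
  define E where "E m = (\<rho> (e i) ^^ m) w" for m
  have E_wt: "E m \<in> wspace (\<lambda>h. lower \<Lambda> k h + of_nat m * \<alpha> i h)" for m
  proof (induction m)
    case 0
    then show ?case using w by (simp add: E_def)
  next
    case (Suc m)
    then show ?case using e_wspace[OF assms(1) Suc] by (simp add: E_def algebra_simps)
  qed
  have root: "\<alpha> i (hc i) = 2"
  proof -
    have "cartan_A n i i = 2" using assms(1) rank_pos by (cases "i = n") (auto simp: cartan_A_def)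
    then show ?thesis using assms(1) by (simp add: root_coroot)
  qed
  have "\<rho> (f i) w \<noteq> 0"
  proof
    assume f0: "\<rho> (f i) w = 0"
    \<comment> \<open>The usual computation for a lowest weight vector; the scalar is nonzero
      because \<open>p > 0\<close>, so no \<open>E m\<close> can vanish.\<close>
    have fE: "\<rho> (f i) (E (Suc m)) = sv (- of_int ((int m + 1) * (p + int m))) (E m)" for m
    proof (induction m)
      case 0
      have "\<rho> (f i) (E 1) = \<rho> (e i) (\<rho> (f i) w) - \<rho> (\<iota> (hc i)) w"
        using action_bracket[of "e i" "f i" w] assms(1) by (simp add: E_def bracket_e_f)
      then show ?case using f0 p wspaceD[OF w(2), of "hc i"] by (simp add: E_def)
    next
      case (Suc m)
      have "\<rho> (f i) (E (Suc (Suc m))) = \<rho> (e i) (\<rho> (f i) (E (Suc m))) - \<rho> (\<iota> (hc i)) (E (Suc m))"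
        using action_bracket[of "e i" "f i" "E (Suc m)"] assms(1) by (simp add: E_def bracket_e_f)
      also have "\<rho> (e i) (\<rho> (f i) (E (Suc m))) = sv (- of_int ((int m + 1) * (p + int m))) (E (Suc m))"
        unfolding Suc by (simp only: action_simps E_def funpow.simps o_apply)
      also have "\<rho> (\<iota> (hc i)) (E (Suc m)) = sv (of_int (p + 2 * (int m + 1))) (E (Suc m))"
        using wspaceD[OF E_wt[of "Suc m"], of "hc i"] p root by (simp add: algebra_simps)
      also have "sv (- of_int ((int m + 1) * (p + int m))) (E (Suc m)) - sv (of_int (p + 2 * (int m + 1))) (E (Suc m))
          = sv (- of_int ((int (Suc m) + 1) * (p + int (Suc m)))) (E (Suc m))"
        unfolding V.scale_left_diff_distrib[symmetric] by (rule arg_cong[of _ _ "\<lambda>c. sv c _"]) (simp add: algebra_simps)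
      finally show ?case .
    qed
    have E_nz: "E m \<noteq> 0" for m
    proof (induction m)
      case 0
      then show ?case using w by (simp add: E_def)
    next
      case (Suc m)
      have "(int m + 1) * (p + int m) \<noteq> 0" using p by simp
      then have "- complex_of_int ((int m + 1) * (p + int m)) \<noteq> 0" by (simp only: of_int_eq_0_iff neg_equal_0_iff_equal not_False_eq_True)
      then have "\<rho> (f i) (E (Suc m)) \<noteq> 0"
        unfolding fE using Suc by (simp only: V.scale_eq_0_iff simp_thms)
      then show ?case by auto
    qed
    \<comment> \<open>One more step than the coefficient of \<open>\<alpha> i\<close> allows: the
      weight of \<open>E ?m\<close> would have coefficient -1 there, contradicting
      \<open>weights_le_highest\<close>.\<close>
    let ?m = "Suc (k i)"
    let ?\<mu> = "\<lambda>h. lower \<Lambda> k h + of_nat ?m * \<alpha> i h"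
    have "Vector_Spaces.linear sh (*) ?\<mu>"
      using linear_lower[OF highest_weight, of k] root_linear[OF assms(1)]
      by (simp add: linear_functional_iff algebra_simps)
    then have "?\<mu> \<in> wts" using E_nz[of ?m] E_wt[of ?m] by (auto simp: weights_def)
    then obtain k' where k': "?\<mu> = lower \<Lambda> k'" by (rule weights_le_highest)
    have "(\<Sum>j\<le>n. of_int (int (k' j) - int (k j) + (if j = i then int ?m else 0)) * \<alpha> j h) = 0" for h
    proof -
      have "(\<Sum>j\<le>n. of_int (int (k' j) - int (k j) + (if j = i then int ?m else 0)) * \<alpha> j h)
        = (\<Sum>j\<le>n. of_nat (k' j) * \<alpha> j h - of_nat (k j) * \<alpha> j h + (if j = i then of_nat ?m * \<alpha> j h else 0))"
        by (rule sum.cong) (auto simp: algebra_simps)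
      also have "\<dots> = lower \<Lambda> k h - lower \<Lambda> k' h + of_nat ?m * \<alpha> i h"
        using assms(1) by (simp add: lower_def sum.distrib sum_subtractf)
      also have "\<dots> = 0" unfolding fun_cong[OF k', of h, symmetric] by simp
      finally show ?thesis .
    qed
    from roots_independent[OF this assms(1)] show False by simp
  qed
  moreover have "\<rho> (f i) w \<in> wspace (lower \<Lambda> (k(i := Suc (k i))))"
    using f_wspace[OF assms(1) w(2)] lower_Suc[OF assms(1)] by (simp add: weight_space_def)
  ultimately show ?thesis
    using linear_lower[OF highest_weight] by (auto simp: weights_def)
qed

text \<open>
  For a weight \<open>\<Lambda> - \<gamma>\<close> with \<open>\<gamma> \<le> k\<close> of maximal height, \<open>k - \<gamma>\<close> is subharmonic on its support;
  by the maximum principle on the cycle it is then constant, and a positive constant would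
  force the level of \<open>\<Lambda>\<close> to be nonpositive.
\<close>

lemma dominant_lower_is_weight:
  fixes lam :: "nat \<Rightarrow> int"
  assumes lam: "\<And>i. i \<le> n \<Longrightarrow> \<Lambda> (hc i) = of_int (lam i)" and level: "(\<Sum>i\<le>n. lam i) > 0"
    and dom: "\<And>i. i \<le> n \<Longrightarrow> (\<Sum>j\<le>n. int (k j) * cartan_A n i j) \<le> lam i"
  shows "lower \<Lambda> k \<in> wts"
proof -
  define P where "P \<gamma> \<longleftrightarrow> (\<forall>j\<le>n. \<gamma> j \<le> k j) \<and> lower \<Lambda> \<gamma> \<in> wts" for \<gamma>
  have "P (\<lambda>_. 0)" using highest_weight_is_weight by (simp add: P_def)
  moreover have "\<forall>\<gamma>. P \<gamma> \<longrightarrow> (\<Sum>j\<le>n. \<gamma> j) < Suc (\<Sum>j\<le>n. k j)"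
    by (auto simp: P_def less_Suc_eq_le intro!: sum_mono)
  ultimately obtain \<gamma> where \<gamma>: "P \<gamma>" "\<And>\<gamma>'. P \<gamma>' \<Longrightarrow> (\<Sum>j\<le>n. \<gamma>' j) \<le> (\<Sum>j\<le>n. \<gamma> j)"
    using Lattices_Big.ex_has_greatest_nat[of P _ "\<lambda>\<gamma>. \<Sum>j\<le>n. \<gamma> j"] by blast
  define u where "u j = int (k j) - int (\<gamma> j)" for j
  \<comment> \<open>A positive label at \<open>i\<close> would let \<open>weight_minus_root\<close>
    raise \<open>\<gamma> i\<close> while staying below \<open>k\<close>, against the choice of
    \<open>\<gamma>\<close>.\<close>
  have nonpos: "lam i \<le> (\<Sum>j\<le>n. int (\<gamma> j) * cartan_A n i j)" if i: "i \<le> n" "u i > 0" for i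
  proof (rule ccontr)
    assume "\<not> ?thesis"
    then have "lam i - (\<Sum>j\<le>n. int (\<gamma> j) * cartan_A n i j) > 0" by simp
    then have "lower \<Lambda> (\<gamma>(i := Suc (\<gamma> i))) \<in> wts"
      using \<gamma>(1) lower_hc[of \<Lambda> i, OF lam[OF i(1)] i(1)] weight_minus_root[OF i(1)]
      unfolding P_def by blast
    then have "P (\<gamma>(i := Suc (\<gamma> i)))" using \<gamma>(1) i by (auto simp: P_def u_def)
    then have "(\<Sum>j\<le>n. (\<gamma>(i := Suc (\<gamma> i))) j) \<le> (\<Sum>j\<le>n. \<gamma> j)" by (rule \<gamma>(2))
    moreover have "(\<Sum>j\<le>n. (\<gamma>(i := Suc (\<gamma> i))) j) > (\<Sum>j\<le>n. \<gamma> j)"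
      by (rule sum_strict_mono_ex1) (use i in auto)
    ultimately show False by simp
  qed
  have sub: "(\<Sum>s\<le>n. u s * cartan_A n i s) \<le> 0" if "i \<le> n" "u i > 0" for i
  proof -
    have "(\<Sum>s\<le>n. u s * cartan_A n i s) =
        (\<Sum>j\<le>n. int (k j) * cartan_A n i j) - (\<Sum>j\<le>n. int (\<gamma> j) * cartan_A n i j)"
      by (simp add: u_def left_diff_distrib sum_subtractf)
    then show ?thesis using nonpos[OF that] dom[OF that(1)] by linarith
  qed
  define M where "M = Max (u ` {..n})"
  have max: "u j \<le> M" if "j \<le> n" for j using that by (simp add: M_def)
  have "M \<in> u ` {..n}" unfolding M_def by (rule Max_in) auto
  then obtain i0 where i0: "i0 \<le> n" "u i0 = M" by auto
  have "M \<le> 0"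
  proof (rule ccontr)
    assume "\<not> M \<le> 0"
    then have M: "M > 0" by simp
    have "u j = M" if "j \<le> n" for j
      by (rule subharmonic_on_cycle_constant[of n u M i0]) (use max i0 sub M that in auto)
    \<comment> \<open>Now \<open>u\<close> is positive everywhere, so \<open>nonpos\<close> holds at
      every node; the right side is 0, while the left side is the level.\<close>
    then have "(\<Sum>i\<le>n. lam i) \<le> (\<Sum>i\<le>n. \<Sum>j\<le>n. int (\<gamma> j) * cartan_A n i j)"
      using M by (intro sum_mono nonpos) auto
    then show False using level sum_sum_cartan_A[of "\<lambda>j. int (\<gamma> j)" n] by simp
  qed
  then have "k j = \<gamma> j" if "j \<le> n" for j
    using max[OF that] \<gamma>(1) that by (fastforce simp: P_def u_def)
  then have "lower \<Lambda> k = lower \<Lambda> \<gamma>" by (simp add: lower_eq_iff)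
  then show ?thesis using \<gamma>(1) by (simp add: P_def)
qed

end

section \<open>Dominant maximal weights\<close>

context irreducible_hw_module
begin

text \<open>Functionals take complex values; on dominant integral ones the conversion through real
  part and floor is exact.\<close>

definition labels :: "('h \<Rightarrow> complex) \<Rightarrow> nat list" where
  "labels \<mu> = map (\<lambda>j. nat \<lfloor>Re (\<mu> (hc j))\<rfloor>) [0..<n + 1]"

text \<open>Equal labels leave a difference of coefficient vectors that is harmonic, hence constant,
  and maximality forces the constant to be 0. For surjectivity, \<open>cartan_A_solvable\<close>
  provides coefficients with a zero entry, which makes the resulting weight maximal.\<close>

lemma dominant_maximal_weights_bij:
  fixes lam :: "nat \<Rightarrow> nat"
  assumes lam: "\<And>i. i \<le> n \<Longrightarrow> \<Lambda> (hc i) = of_nat (lam i)" and level: "(\<Sum>i\<le>n. lam i) > 0"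
  shows "bij_betw labels (dominant_maximal_weights sh n hc \<alpha> sv \<iota> \<rho>)
    (weighted_compositions n (\<Sum>i\<le>n. lam i) (\<Sum>i\<le>n. i * lam i))"
proof -
  let ?l = "\<Sum>i\<le>n. lam i" and ?D = "dominant_maximal_weights sh n hc \<alpha> sv \<iota> \<rho>"
    and ?C = "weighted_compositions n (\<Sum>i\<le>n. lam i) (\<Sum>i\<le>n. i * lam i)"
  define m where "m k i = int (lam i) - (\<Sum>j\<le>n. int (k j) * cartan_A n i j)" for k :: "nat \<Rightarrow> nat" and i
  have label: "lower \<Lambda> k (hc i) = of_int (m k i)" if "i \<le> n" for k i
    using lower_hc[of \<Lambda> i "int (lam i)"] lam that by (simp add: m_def)
  have weight: "lower \<Lambda> k \<in> wts" if "\<And>i. i \<le> n \<Longrightarrow> 0 \<le> m k i" for k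
  proof (rule dominant_lower_is_weight[of "\<lambda>i. int (lam i)"])
    show "(\<Sum>i\<le>n. int (lam i)) > 0" using level by (metis of_nat_0_less_iff of_nat_sum)
  qed (use lam that in \<open>auto simp: m_def\<close>)
  have shift: "(\<lambda>h. lower \<Lambda> (\<lambda>j. Suc (k j)) h + null_root n \<alpha> h) = lower \<Lambda> k" for k
    by (rule ext) (rule lower_plus_null_root)
  have D: "\<exists>k. \<mu> = lower \<Lambda> k \<and> (\<forall>i\<le>n. 0 \<le> m k i)" if "\<mu> \<in> ?D" for \<mu>
  proof -
    have "\<mu> \<in> wts" "dominant_integral n hc \<mu>"
      using that by (auto simp: dominant_maximal_weights_def maximal_weights_def)
    then obtain k where k: "\<mu> = lower \<Lambda> k" using weights_le_highest by blast
    have "0 \<le> m k i" if i: "i \<le> n" for i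
    proof -
      have "complex_of_int (m k i) \<in> \<nat>"
        using \<open>dominant_integral n hc \<mu>\<close> i by (simp add: dominant_integral_def k label)
      then obtain q where "complex_of_int (m k i) = of_nat q" by (auto elim: Nats_cases)
      then have "complex_of_int (m k i) = of_int (int q)" by simp
      then show ?thesis by (simp only: of_int_eq_iff)
    qed
    then show ?thesis using k by blast
  qed
  have labels_nth: "labels (lower \<Lambda> k) ! i = nat (m k i)" if "i \<le> n" for k i
    using that by (simp add: labels_def label del: upt_Suc)
  \<comment> \<open>Lowering every coefficient by one adds the null root and keeps the labels, so
    the result is again dominant and hence a weight.\<close>
  have not_above: "lower \<Lambda> k \<notin> ?D" if "\<And>i. i \<le> n \<Longrightarrow> 0 \<le> m k i" "\<And>j. j \<le> n \<Longrightarrow> k j > 0" for k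
  proof -
    let ?k = "\<lambda>j. k j - 1"
    have eq: "lower \<Lambda> k = lower \<Lambda> (\<lambda>j. Suc (?k j))"
      using that(2) by (simp add: lower_eq_iff)
    have "m ?k i = m k i" if i: "i \<le> n" for i
    proof -
      have "(\<Sum>j\<le>n. int (?k j) * cartan_A n i j) = (\<Sum>j\<le>n. int (k j) * cartan_A n i j - cartan_A n i j)"
        by (rule sum.cong) (use \<open>\<And>j. j \<le> n \<Longrightarrow> k j > 0\<close> in \<open>auto simp: algebra_simps of_nat_diff Suc_le_eq\<close>)
      then show ?thesis using sum_cartan_A_const[OF i] by (simp add: m_def sum_subtractf)
    qed
    then have "lower \<Lambda> ?k \<in> wts" using that(1) by (intro weight) simp
    then show ?thesis
      unfolding eq dominant_maximal_weights_def maximal_weights_def by (simp add: shift)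
  qed
  show ?thesis
    unfolding bij_betw_def
  proof (intro conjI equalityI subsetI)
    show "inj_on labels ?D"
    proof (rule inj_onI)
      fix \<mu> \<mu>' assume \<mu>: "\<mu> \<in> ?D" and \<mu>': "\<mu>' \<in> ?D" and eq: "labels \<mu> = labels \<mu>'"
      obtain k where k: "\<mu> = lower \<Lambda> k" "\<And>i. i \<le> n \<Longrightarrow> 0 \<le> m k i" using D[OF \<mu>] by blast
      obtain k' where k': "\<mu>' = lower \<Lambda> k'" "\<And>i. i \<le> n \<Longrightarrow> 0 \<le> m k' i" using D[OF \<mu>'] by blast
      have meq: "m k i = m k' i" if "i \<le> n" for i
      proof -
        have "nat (m k i) = nat (m k' i)"
          using eq labels_nth[OF that] by (metis k(1) k'(1))
        then show ?thesis using k(2)[OF that] k'(2)[OF that] by simp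
      qed
      define u where "u j = int (k j) - int (k' j)" for j
      have u: "u j = u 0" if "j \<le> n" for j
      proof (rule harmonic_on_cycle_constant[OF _ that])
        fix i assume "i \<le> n"
        then show "(\<Sum>s\<le>n. u s * cartan_A n i s) = 0"
          using meq[of i] by (simp add: u_def m_def left_diff_distrib sum_subtractf)
      qed
      have "\<not> u 0 > 0"
      proof
        assume "u 0 > 0"
        then have "k j > 0" if "j \<le> n" for j using u[OF that] by (simp add: u_def)
        then show False using not_above[OF k(2)] \<mu> k(1) by blast
      qed
      moreover have "\<not> u 0 < 0"
      proof
        assume "u 0 < 0"
        then have "k' j > 0" if "j \<le> n" for j using u[OF that] by (simp add: u_def)
        then show False using not_above[OF k'(2)] \<mu>' k'(1) by blast
      qed
      ultimately have "u 0 = 0" by simp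
      then have "k j = k' j" if "j \<le> n" for j using u[OF that] by (simp add: u_def)
      then show "\<mu> = \<mu>'" using k k' by (simp add: lower_eq_iff)
    qed
  next
    fix xs assume "xs \<in> labels ` ?D"
    then obtain \<mu> where \<mu>: "\<mu> \<in> ?D" "xs = labels \<mu>" by blast
    obtain k where k: "\<mu> = lower \<Lambda> k" "\<And>i. i \<le> n \<Longrightarrow> 0 \<le> m k i" using D[OF \<mu>(1)] by blast
    have nth: "int (xs ! i) = m k i" if "i \<le> n" for i
      using labels_nth[OF that] k \<mu> that by simp
    have len: "length xs = n + 1" by (simp add: \<mu>(2) labels_def)
    have "int (sum_list xs) = (\<Sum>i\<le>n. m k i)"
      using nth len by (simp add: sum_list_sum_nth atLeast0LessThan lessThan_Suc_atMost del: lessThan_Suc)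
    also have "\<dots> = int ?l"
      using sum_sum_cartan_A[of "\<lambda>j. int (k j)" n] by (simp add: m_def sum_subtractf)
    finally have "sum_list xs = ?l" by (simp only: of_nat_eq_iff)
    moreover have "(\<Sum>j\<le>n. j * xs ! j) mod (n + 1) = (\<Sum>i\<le>n. i * lam i) mod (n + 1)"
    proof -
      have "int (\<Sum>j\<le>n. j * xs ! j) = (\<Sum>j\<le>n. int j * m k j)"
        by (simp add: nth)
      also have "\<dots> = int (\<Sum>i\<le>n. i * lam i) - (\<Sum>i\<le>n. int i * (\<Sum>j\<le>n. int (k j) * cartan_A n i j))"
        by (simp add: m_def right_diff_distrib sum_subtractf)
      finally have "int (n + 1) dvd int (\<Sum>i\<le>n. i * lam i) - int (\<Sum>j\<le>n. j * xs ! j)"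
        using dvd_weighted_sum_cartan_A[of n "\<lambda>j. int (k j)"] by simp
      then have "int (\<Sum>i\<le>n. i * lam i) mod int (n + 1) = int (\<Sum>j\<le>n. j * xs ! j) mod int (n + 1)"
        by (simp only: mod_eq_dvd_iff)
      then show ?thesis by (simp only: of_nat_eq_iff flip: of_nat_mod)
    qed
    ultimately show "xs \<in> ?C" using len by (simp add: weighted_compositions_def natpermute_def)
  next
    fix xs assume "xs \<in> ?C"
    then have xs: "length xs = n + 1" "sum_list xs = ?l"
      "(\<Sum>j\<le>n. j * xs ! j) mod (n + 1) = (\<Sum>i\<le>n. i * lam i) mod (n + 1)"
      by (auto simp: weighted_compositions_def natpermute_def)
    define c where "c i = int (lam i) - int (xs ! i)" for i
    have "(\<Sum>i\<le>n. xs ! i) = ?l"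
      using xs by (simp add: sum_list_sum_nth atLeast0LessThan lessThan_Suc_atMost del: lessThan_Suc)
    then have "(\<Sum>i\<le>n. int (xs ! i)) = (\<Sum>i\<le>n. int (lam i))" by (simp only: flip: of_nat_sum)
    then have c0: "(\<Sum>i\<le>n. c i) = 0" by (simp add: c_def sum_subtractf)
    have "int (\<Sum>i\<le>n. i * lam i) mod int (n + 1) = int (\<Sum>j\<le>n. j * xs ! j) mod int (n + 1)"
      using xs(3) by (simp only: flip: of_nat_mod)
    then have "int (n + 1) dvd int (\<Sum>i\<le>n. i * lam i) - int (\<Sum>j\<le>n. j * xs ! j)"
      by (simp only: mod_eq_dvd_iff)
    also have "\<dots> = (\<Sum>i\<le>n. int i * c i)"
      by (simp add: c_def right_diff_distrib sum_subtractf)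
    finally obtain k where k: "\<And>i. i \<le> n \<Longrightarrow> (\<Sum>j\<le>n. int (k j) * cartan_A n i j) = c i"
        and k0: "\<exists>j\<le>n. k j = 0"
      using cartan_A_solvable[OF rank_pos c0] by blast
    have m: "m k i = int (xs ! i)" if "i \<le> n" for i
      using k[OF that] by (simp add: m_def c_def)
    have "lower \<Lambda> k \<in> wts" using m by (intro weight) simp
    moreover have "(\<lambda>h. lower \<Lambda> k h + null_root n \<alpha> h) \<notin> wts"
    proof
      assume "(\<lambda>h. lower \<Lambda> k h + null_root n \<alpha> h) \<in> wts"
      then obtain k' where k': "(\<lambda>h. lower \<Lambda> k h + null_root n \<alpha> h) = lower \<Lambda> k'"
        by (rule weights_le_highest)
      have "lower \<Lambda> k h = lower \<Lambda> (\<lambda>j. Suc (k' j)) h" for h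
        using fun_cong[OF k', of h] lower_plus_null_root[of \<Lambda> k' h] by (metis add_right_cancel)
      then have "lower \<Lambda> k = lower \<Lambda> (\<lambda>j. Suc (k' j))" by blast
      then show False using k0 by (auto simp: lower_eq_iff)
    qed
    moreover have "dominant_integral n hc (lower \<Lambda> k)"
      by (simp add: dominant_integral_def label m)
    ultimately have "lower \<Lambda> k \<in> ?D"
      by (simp add: dominant_maximal_weights_def maximal_weights_def)
    moreover have "labels (lower \<Lambda> k) = xs"
      by (rule nth_equalityI) (use xs labels_nth m in \<open>auto simp: labels_def less_Suc_eq_le simp del: upt_Suc\<close>)
    ultimately show "xs \<in> labels ` ?D" by blast
  qed
qed

end

theorem theorem4p5:
  fixes n l i :: nat
    and sh :: "complex \<Rightarrow> 'h::ab_group_add \<Rightarrow> 'h"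
    and hc :: "nat \<Rightarrow> 'h"
    and d :: 'h
    and \<alpha> :: "nat \<Rightarrow> 'h \<Rightarrow> complex"
    and sg :: "complex \<Rightarrow> 'g::ab_group_add \<Rightarrow> 'g"
    and br :: "'g \<Rightarrow> 'g \<Rightarrow> 'g"
    and \<iota> :: "'h \<Rightarrow> 'g"
    and e f :: "nat \<Rightarrow> 'g"
    and sv :: "complex \<Rightarrow> 'v::ab_group_add \<Rightarrow> 'v"
    and \<rho> :: "'g \<Rightarrow> 'v \<Rightarrow> 'v"
  assumes "1 \<le> n" and "1 \<le> l" and "i \<le> n"
    and "irreducible_hw_module sh n hc d \<alpha> sg br \<iota> e f sv \<rho>
           (\<lambda>h. of_nat (l - 1) * fundamental_weight sh n hc d 0 h + fundamental_weight sh n hc d i h)"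
  shows "finite (dominant_maximal_weights sh n hc \<alpha> sv \<iota> \<rho>) \<and>
    real (card (dominant_maximal_weights sh n hc \<alpha> sv \<iota> \<rho>)) =
      (\<Sum>k | k dvd gcd (gcd (n + 1) l) i.
         real k / real ((n + 1) + l) *
         (\<Sum>k' | k' dvd gcd ((n + 1) div k) (l div k).
            real_of_int (moebius k') *
            real ((((n + 1) + l) div (k * k')) choose (l div (k * k')))))"
proof -
  interpret irreducible_hw_module sh n hc d \<alpha> sg br \<iota> e f sv \<rho>
      "\<lambda>h. of_nat (l - 1) * fundamental_weight sh n hc d 0 h + fundamental_weight sh n hc d i h"
    by (rule assms(4))
  \<comment> \<open>Adding two indicators also covers \<open>i = 0\<close>, where the single nonzero
    label is \<open>l\<close>.\<close>
  define lam where "lam j = (if j = 0 then l - 1 else 0) + (if j = i then 1 else 0)" for j :: nat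
  have "bij_betw labels (dominant_maximal_weights sh n hc \<alpha> sv \<iota> \<rho>)
      (weighted_compositions n (\<Sum>j\<le>n. lam j) (\<Sum>j\<le>n. j * lam j))"
  proof (rule dominant_maximal_weights_bij)
    show "0 < (\<Sum>j\<le>n. lam j)" using assms(3) by (intro sum_pos2[of _ i]) (auto simp: lam_def)
  qed (use assms(3) in \<open>auto simp: lam_def fundamental_weight_props\<close>)
  moreover have "(\<Sum>j\<le>n. lam j) = l"
    using assms(2,3) by (simp add: lam_def sum.distrib)
  \<comment> \<open>The \<open>l - 1\<close> copies at node 0 have weight 0, so the residue is
    \<open>i\<close> itself.\<close>
  moreover have "(\<Sum>j\<le>n. j * lam j) = (\<Sum>j\<le>n. if j = i then i else 0)"
    by (rule sum.cong) (auto simp: lam_def)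
  then have "(\<Sum>j\<le>n. j * lam j) = i" using assms(3) by simp
  ultimately have bij: "bij_betw labels (dominant_maximal_weights sh n hc \<alpha> sv \<iota> \<rho>) (weighted_compositions n l i)"
    by simp
  show ?thesis
    unfolding bij_betw_same_card[OF bij] card_weighted_compositions[OF assms(3)]
    using bij_betw_finite[OF bij] finite_weighted_compositions by simp
qed

end
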